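(* Let $f:(M,h)\to(N,g)$ be a pluri-harmonic map from a Hermitian manifold $(M,h)$ to a Riemannian manifold $(N,g)$, and let $u=|\partial f|^2$. Then $$\partial\bar\partial u=\langle\partial_{\mathscr F}\partial f,\partial_{\mathscr F}\partial f\rangle+\left(R^M_{\alpha\bar\beta\gamma\bar\delta}h^{\gamma\bar\nu}h^{\mu\bar\delta}g_{ij}f^i_\mu f^j_{\bar\nu}-R^N_{i\ell kj}f^i_\alpha f^j_{\bar\beta}\left(h^{\gamma\bar\delta}f^k_\gamma f^\ell_{\bar\delta}\right)\right)dz^\alpha\wedge d\bar z^\beta,$$ where $R^M_{\alpha\bar\beta\gamma\bar\delta}$ is the curvature of the Chern connection on $T^{1,0}M$ and $\partial_{\mathscr F}$ is the induced $(1,0)$ connection on the vector bundle $\mathscr F=T^{*1,0}M\otimes f^*TN$.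
   Context: Maps are smooth; $\{z^\alpha\}$ are local holomorphic coordinates on $M$, $\{y^i\}$ local coordinates on $N$, and repeated indices are summed. Write $f^i_\alpha=\partial f^i/\partial z^\alpha$, $f^j_{\bar\beta}=\partial f^j/\partial\bar z^\beta$, $e_i=f^*(\partial/\partial y^i)$, and $\partial f=f^i_\alpha\,dz^\alpha\otimes e_i\in\Gamma(M,\mathscr F)$. Thus $|\partial f|^2=h^{\alpha\bar\beta}g_{ij}f^i_\alpha f^j_{\bar\beta}$. In $\mathscr F$, $f^*TN$ is understood complexified, with the Hermitian metric induced by $g$. Pluri-harmonic means $$\left(\frac{\partial^2 f^i}{\partial z^\alpha\partial\bar z^\beta}+\Gamma^i_{jk}\frac{\partial f^j}{\partial\bar z^\beta}\frac{\partial f^k}{\partial z^\alpha}\right)dz^\alpha\wedge d\bar z^\beta\otimes e_i=0,$$ with $\Gamma^i_{jk}$ the Christoffel symbols of $g$ evaluated along $f$. The connection $\nabla^{\mathscr F}=\partial_{\mathscr F}+\bar\partial_{\mathscr F}$ on $\mathscr F$ is induced by the Chern connection of $(M,h)$ and the Levi-Civita connection of $(N,g)$; $\partial_{\mathscr F}$ is its $(1,0)$ part. The bracket $\langle\cdot,\cdot\rangle$ of $\mathscr F$-valued forms is the Hermitian pairing on $\mathscr F$ combined with the wedge product on forms: $\langle\phi\otimes s,\psi\otimes t\rangle=\langle s,t\rangle\,\phi\wedge\bar\psi$. So $\langle\partial_{\mathscr F}\partial f,\partial_{\mathscr F}\partial f\rangle$ is the $(1,1)$-form $\langle\nabla^{\mathscr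 F}_{\partial_\alpha}\partial f,\nabla^{\mathscr F}_{\partial_\beta}\partial f\rangle\,dz^\alpha\wedge d\bar z^\beta$. Curvature conventions: $R^M_{\alpha\bar\beta\gamma\bar\delta}=-\frac{\partial^2 h_{\gamma\bar\delta}}{\partial z^\alpha\partial\bar z^\beta}+h^{\mu\bar\nu}\frac{\partial h_{\gamma\bar\nu}}{\partial z^\alpha}\frac{\partial h_{\mu\bar\delta}}{\partial\bar z^\beta}$. On $N$, $R(X,Y)Z=\nabla_X\nabla_YZ-\nabla_Y\nabla_XZ-\nabla_{[X,Y]}Z$ and $R^N_{ijk\ell}X^iY^jZ^kW^\ell=g(R(X,Y)Z,W)$. *)

theory Defs
  imports "HOL-Analysis.Analysis"
begin

section \<open>Smooth and holomorphic maps on open subsets of Euclidean spaces\<close>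

text \<open>Intended for open sets; \<open>C k F S\<close> says that all iterated directional derivatives
  of order at most \<open>k\<close> exist and are continuous.\<close>

primrec Ck_on :: "nat \<Rightarrow> ('a::real_normed_vector \<Rightarrow> 'b::real_normed_vector) \<Rightarrow> 'a set \<Rightarrow> bool" where
  "Ck_on 0 F S \<longleftrightarrow> continuous_on S F"
| "Ck_on (Suc k) F S \<longleftrightarrow>
     (\<forall>x\<in>S. F differentiable (at x)) \<and> (\<forall>v. Ck_on k (\<lambda>x. frechet_derivative F (at x) v) S)"

definition smooth_on :: "('a::real_normed_vector \<Rightarrow> 'b::real_normed_vector) \<Rightarrow> 'a set \<Rightarrow> bool" where
  "smooth_on F S \<longleftrightarrow> (\<forall>k. Ck_on k F S)"

definition holomorphic_map_on :: "(complex^'m \<Rightarrow> complex^'k) \<Rightarrow> (complex^'m) set \<Rightarrow> bool" where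
  "holomorphic_map_on F S \<longleftrightarrow>
     (\<forall>x\<in>S. \<exists>D. (F has_derivative D) (at x) \<and> (\<forall>a v. D (a *s v) = a *s D v))"

section \<open>Manifolds\<close>

text \<open>The manifold is the whole (Hausdorff, second countable) type; a chart is an open set
  with coordinates. An atlas need not be maximal.\<close>

record ('a, 'e) chart =
  cdom :: "'a set"
  cmap :: "'a \<Rightarrow> 'e"

definition cinv :: "('a, 'e) chart \<Rightarrow> 'e \<Rightarrow> 'a" where
  "cinv c = inv_into (cdom c) (cmap c)"

definition atlas ::
  "(('e::euclidean_space \<Rightarrow> 'e) \<Rightarrow> 'e set \<Rightarrow> bool)
    \<Rightarrow> ('a::{t2_space,second_countable_topology}, 'e) chart set \<Rightarrow> bool" where
  "atlas P A \<longleftrightarrow>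
     (\<forall>c\<in>A. open (cdom c) \<and> open (cmap c ` cdom c)
        \<and> homeomorphism (cdom c) (cmap c ` cdom c) (cmap c) (cinv c))
     \<and> (\<Union>c\<in>A. cdom c) = UNIV
     \<and> (\<forall>c\<in>A. \<forall>c'\<in>A. P (cmap c' \<circ> cinv c) (cmap c ` (cdom c \<inter> cdom c')))"

abbreviation complex_atlas ::
  "('a::{t2_space,second_countable_topology}, complex^'m) chart set \<Rightarrow> bool" where
  "complex_atlas \<equiv> atlas holomorphic_map_on"

abbreviation smooth_atlas ::
  "('b::{t2_space,second_countable_topology}, real^'n) chart set \<Rightarrow> bool" where
  "smooth_atlas \<equiv> atlas smooth_on"

definition smooth_map ::
  "('a::topological_space, 'e::euclidean_space) chart set
    \<Rightarrow> ('b::topological_space, 'e'::euclidean_space) chart set \<Rightarrow> ('a \<Rightarrow> 'b) \<Rightarrow> bool" where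
  "smooth_map A B f \<longleftrightarrow> continuous_on UNIV f \<and>
     (\<forall>c\<in>A. \<forall>d\<in>B. smooth_on (cmap d \<circ> f \<circ> cinv c) (cmap c ` (cdom c \<inter> f -` cdom d)))"

section \<open>Coordinate derivatives and forms\<close>

text \<open>\<open>dirD c F v p\<close> is the derivative of \<open>F\<close> at \<open>p\<close> along the real tangent vector whose
  components in the chart \<open>c\<close> are \<open>v\<close>. On a complex manifold \<open>v :: complex^'m\<close> stands for
  the real tangent vector with \<open>dz\<^sup>\<alpha>(v) = v $ \<alpha>\<close>.\<close>

definition dirD ::
  "('a, 'e::real_normed_vector) chart \<Rightarrow> ('a \<Rightarrow> 'k::real_normed_vector) \<Rightarrow> 'e \<Rightarrow> 'a \<Rightarrow> 'k" where
  "dirD c F v p = frechet_derivative (F \<circ> cinv c) (at (cmap c p)) v"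

text \<open>A real-linear complex-valued form on tangent vectors is
  \<open>T = T\<^sub>\<alpha> dz\<^sup>\<alpha> + T\<^sub>\<alpha>\<^sub>' dzbar\<^sup>\<alpha>\<close>; these are its two families of coefficients, that is, the values
  of (the complex-linear extension of) \<open>T\<close> on
  \<open>\<partial>\<^sub>\<alpha> = (\<partial>/\<partial>x\<^sup>\<alpha> - \<i> \<partial>/\<partial>y\<^sup>\<alpha>)/2\<close> and on its conjugate.\<close>

definition coeff10 :: "(complex^'m \<Rightarrow> complex) \<Rightarrow> 'm \<Rightarrow> complex" where
  "coeff10 T \<alpha> = (T (axis \<alpha> 1) - \<i> * T (axis \<alpha> \<i>)) / 2"

definition coeff01 :: "(complex^'m \<Rightarrow> complex) \<Rightarrow> 'm \<Rightarrow> complex" where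
  "coeff01 T \<alpha> = (T (axis \<alpha> 1) + \<i> * T (axis \<alpha> \<i>)) / 2"

definition pdz :: "('a, complex^'m) chart \<Rightarrow> 'm \<Rightarrow> ('a \<Rightarrow> complex) \<Rightarrow> 'a \<Rightarrow> complex" where
  "pdz c \<alpha> F p = coeff10 (\<lambda>v. dirD c F v p) \<alpha>"

definition pdzbar :: "('a, complex^'m) chart \<Rightarrow> 'm \<Rightarrow> ('a \<Rightarrow> complex) \<Rightarrow> 'a \<Rightarrow> complex" where
  "pdzbar c \<beta> F p = coeff01 (\<lambda>v. dirD c F v p) \<beta>"

definition pdy :: "('b, real^'n) chart \<Rightarrow> 'n \<Rightarrow> ('b \<Rightarrow> real) \<Rightarrow> 'b \<Rightarrow> real" where
  "pdy d k G q = dirD d G (axis k 1) q"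

definition wedge :: "('v \<Rightarrow> complex) \<Rightarrow> ('v \<Rightarrow> complex) \<Rightarrow> 'v \<Rightarrow> 'v \<Rightarrow> complex" where
  "wedge \<phi> \<psi> v w = \<phi> v * \<psi> w - \<phi> w * \<psi> v"

text \<open>The (1,1)-form \<open>a\<^sub>\<alpha>\<^sub>\<beta> dz\<^sup>\<alpha> \<and> dzbar\<^sup>\<beta>\<close> at a point.\<close>

definition form11 :: "('m \<Rightarrow> 'm \<Rightarrow> complex) \<Rightarrow> complex^'m \<Rightarrow> complex^'m \<Rightarrow> complex" where
  "form11 a v w =
     (\<Sum>\<alpha>\<in>UNIV. \<Sum>\<beta>\<in>UNIV. a \<alpha> \<beta> * wedge (\<lambda>v. v $ \<alpha>) (\<lambda>v. cnj (v $ \<beta>)) v w)"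

text \<open>\<open>\<partial>(dbar u)\<close> with \<open>dbar u = (\<partial>u/\<partial>zbar\<^sup>\<beta>) dzbar\<^sup>\<beta>\<close> and
  \<open>\<partial>(\<omega>\<^sub>\<beta> dzbar\<^sup>\<beta>) = (\<partial>\<omega>\<^sub>\<beta>/\<partial>z\<^sup>\<alpha>) dz\<^sup>\<alpha> \<and> dzbar\<^sup>\<beta>\<close>.\<close>

definition del_delbar ::
  "('a, complex^'m) chart \<Rightarrow> ('a \<Rightarrow> complex) \<Rightarrow> 'a \<Rightarrow> complex^'m \<Rightarrow> complex^'m \<Rightarrow> complex" where
  "del_delbar c u p = form11 (\<lambda>\<alpha> \<beta>. pdz c \<alpha> (pdzbar c \<beta> u) p)"

section \<open>Metrics\<close>

text \<open>Metrics are given by their components in every chart: \<open>h c p $ \<alpha> $ \<beta>\<close> is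
  \<open>h(\<partial>\<^sub>\<alpha>, \<partial>\<^sub>\<beta>bar)\<close> and \<open>g d q $ i $ j\<close> is \<open>g(\<partial>\<^sub>i, \<partial>\<^sub>j)\<close>. The last conjunct of each definition is the
  transformation law of the components under change of chart.\<close>

definition hermitian_metric ::
  "('a, complex^'m) chart set \<Rightarrow> (('a, complex^'m) chart \<Rightarrow> 'a \<Rightarrow> complex^'m^'m) \<Rightarrow> bool" where
  "hermitian_metric A h \<longleftrightarrow>
     (\<forall>c\<in>A. smooth_on (h c \<circ> cinv c) (cmap c ` cdom c)
        \<and> (\<forall>p\<in>cdom c. (\<forall>\<alpha> \<beta>. h c p $ \<beta> $ \<alpha> = cnj (h c p $ \<alpha> $ \<beta>))
            \<and> (\<forall>v. v \<noteq> 0 \<longrightarrow>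
                 Re (\<Sum>\<alpha>\<in>UNIV. \<Sum>\<beta>\<in>UNIV. h c p $ \<alpha> $ \<beta> * v $ \<alpha> * cnj (v $ \<beta>)) > 0)))
     \<and> (\<forall>c\<in>A. \<forall>c'\<in>A. \<forall>p\<in>cdom c \<inter> cdom c'. \<forall>\<alpha> \<beta>.
          h c p $ \<alpha> $ \<beta> =
            (\<Sum>\<mu>\<in>UNIV. \<Sum>\<nu>\<in>UNIV. h c' p $ \<mu> $ \<nu>
               * pdz c \<alpha> (\<lambda>q. cmap c' q $ \<mu>) p * cnj (pdz c \<beta> (\<lambda>q. cmap c' q $ \<nu>) p)))"

definition riemannian_metric ::
  "('b, real^'n) chart set \<Rightarrow> (('b, real^'n) chart \<Rightarrow> 'b \<Rightarrow> real^'n^'n) \<Rightarrow> bool" where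
  "riemannian_metric B g \<longleftrightarrow>
     (\<forall>d\<in>B. smooth_on (g d \<circ> cinv d) (cmap d ` cdom d)
        \<and> (\<forall>q\<in>cdom d. (\<forall>i j. g d q $ j $ i = g d q $ i $ j)
            \<and> (\<forall>v. v \<noteq> 0 \<longrightarrow> (\<Sum>i\<in>UNIV. \<Sum>j\<in>UNIV. g d q $ i $ j * v $ i * v $ j) > 0)))
     \<and> (\<forall>d\<in>B. \<forall>d'\<in>B. \<forall>q\<in>cdom d \<inter> cdom d'. \<forall>i j.
          g d q $ i $ j =
            (\<Sum>k\<in>UNIV. \<Sum>l\<in>UNIV. g d' q $ k $ l
               * pdy d i (\<lambda>x. cmap d' x $ k) q * pdy d j (\<lambda>x. cmap d' x $ l) q))"

definition hermitian_manifold ::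
  "('a::{t2_space,second_countable_topology}, complex^'m) chart set
    \<Rightarrow> (('a, complex^'m) chart \<Rightarrow> 'a \<Rightarrow> complex^'m^'m) \<Rightarrow> bool" where
  "hermitian_manifold A h \<longleftrightarrow> complex_atlas A \<and> hermitian_metric A h"

definition riemannian_manifold ::
  "('b::{t2_space,second_countable_topology}, real^'n) chart set
    \<Rightarrow> (('b, real^'n) chart \<Rightarrow> 'b \<Rightarrow> real^'n^'n) \<Rightarrow> bool" where
  "riemannian_manifold B g \<longleftrightarrow> smooth_atlas B \<and> riemannian_metric B g"

text \<open>\<open>upper H \<alpha> \<beta>\<close> is \<open>h\<^sup>\<alpha>\<^sup>\<beta>\<close> with barred second index, normalised by
  \<open>h\<^sup>\<alpha>\<^sup>\<beta> h\<^sub>\<gamma>\<^sub>\<beta> = \<delta>\<close> (barred indices contracted); hence the transposition.\<close>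

definition upper :: "'k::field^'m^'m \<Rightarrow> 'm \<Rightarrow> 'm \<Rightarrow> 'k" where
  "upper H \<alpha> \<beta> = matrix_inv H $ \<beta> $ \<alpha>"

section \<open>Levi-Civita connection and curvature of the target\<close>

definition christoffel ::
  "(('b, real^'n) chart \<Rightarrow> 'b \<Rightarrow> real^'n^'n) \<Rightarrow> ('b, real^'n) chart \<Rightarrow> 'n \<Rightarrow> 'n \<Rightarrow> 'n \<Rightarrow> 'b \<Rightarrow> real" where
  "christoffel g d i j k q = (1/2) * (\<Sum>l\<in>UNIV. upper (g d q) i l *
     (pdy d j (\<lambda>x. g d x $ k $ l) q + pdy d k (\<lambda>x. g d x $ j $ l) q - pdy d l (\<lambda>x. g d x $ j $ k) q))"

text \<open>Vector fields on the domain of \<open>d\<close> are given by their components.\<close>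

definition levi_civita ::
  "(('b, real^'n) chart \<Rightarrow> 'b \<Rightarrow> real^'n^'n) \<Rightarrow> ('b, real^'n) chart
    \<Rightarrow> ('b \<Rightarrow> real^'n) \<Rightarrow> ('b \<Rightarrow> real^'n) \<Rightarrow> 'b \<Rightarrow> real^'n" where
  "levi_civita g d X Y q = (\<chi> i. (\<Sum>j\<in>UNIV. X q $ j * pdy d j (\<lambda>x. Y x $ i) q)
     + (\<Sum>j\<in>UNIV. \<Sum>k\<in>UNIV. christoffel g d i j k q * X q $ j * Y q $ k))"

definition lie_bracket ::
  "('b, real^'n) chart \<Rightarrow> ('b \<Rightarrow> real^'n) \<Rightarrow> ('b \<Rightarrow> real^'n) \<Rightarrow> 'b \<Rightarrow> real^'n" where
  "lie_bracket d X Y q = (\<chi> i. \<Sum>j\<in>UNIV.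
     X q $ j * pdy d j (\<lambda>x. Y x $ i) q - Y q $ j * pdy d j (\<lambda>x. X x $ i) q)"

definition riemann_op ::
  "(('b, real^'n) chart \<Rightarrow> 'b \<Rightarrow> real^'n^'n) \<Rightarrow> ('b, real^'n) chart
    \<Rightarrow> ('b \<Rightarrow> real^'n) \<Rightarrow> ('b \<Rightarrow> real^'n) \<Rightarrow> ('b \<Rightarrow> real^'n) \<Rightarrow> 'b \<Rightarrow> real^'n" where
  "riemann_op g d X Y Z q =
     levi_civita g d X (levi_civita g d Y Z) q - levi_civita g d Y (levi_civita g d X Z) q
     - levi_civita g d (lie_bracket d X Y) Z q"

definition RN ::
  "(('b, real^'n) chart \<Rightarrow> 'b \<Rightarrow> real^'n^'n) \<Rightarrow> ('b, real^'n) chart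
    \<Rightarrow> 'n \<Rightarrow> 'n \<Rightarrow> 'n \<Rightarrow> 'n \<Rightarrow> 'b \<Rightarrow> real" where
  "RN g d i j k l q = (\<Sum>a\<in>UNIV. \<Sum>b\<in>UNIV. g d q $ a $ b *
     riemann_op g d (\<lambda>_. axis i 1) (\<lambda>_. axis j 1) (\<lambda>_. axis k 1) q $ a * axis l 1 $ b)"

section \<open>Chern connection and curvature of the source\<close>

text \<open>\<open>\<nabla>\<^sub>\<alpha> \<partial>\<^sub>\<gamma> = chern h c \<mu> \<alpha> \<gamma> \<partial>\<^sub>\<mu>\<close> on \<open>T\<^sup>1\<^sup>,\<^sup>0M\<close>; the connection form is of type (1,0),
  so the coefficients in the barred directions vanish.\<close>

definition chern ::
  "(('a, complex^'m) chart \<Rightarrow> 'a \<Rightarrow> complex^'m^'m) \<Rightarrow> ('a, complex^'m) chart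
    \<Rightarrow> 'm \<Rightarrow> 'm \<Rightarrow> 'm \<Rightarrow> 'a \<Rightarrow> complex" where
  "chern h c \<mu> \<alpha> \<gamma> p = (\<Sum>\<delta>\<in>UNIV. upper (h c p) \<mu> \<delta> * pdz c \<alpha> (\<lambda>q. h c q $ \<gamma> $ \<delta>) p)"

definition RM ::
  "(('a, complex^'m) chart \<Rightarrow> 'a \<Rightarrow> complex^'m^'m) \<Rightarrow> ('a, complex^'m) chart
    \<Rightarrow> 'm \<Rightarrow> 'm \<Rightarrow> 'm \<Rightarrow> 'm \<Rightarrow> 'a \<Rightarrow> complex" where
  "RM h c \<alpha> \<beta> \<gamma> \<delta> p =
     - pdz c \<alpha> (pdzbar c \<beta> (\<lambda>q. h c q $ \<gamma> $ \<delta>)) p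
     + (\<Sum>\<mu>\<in>UNIV. \<Sum>\<nu>\<in>UNIV. upper (h c p) \<mu> \<nu>
          * pdz c \<alpha> (\<lambda>q. h c q $ \<gamma> $ \<nu>) p * pdzbar c \<beta> (\<lambda>q. h c q $ \<mu> $ \<delta>) p)"

section \<open>The bundle \<open>T\<^sup>*\<^sup>1\<^sup>,\<^sup>0M \<otimes> f\<^sup>*TN\<close>\<close>

text \<open>Relative to charts \<open>c\<close> and \<open>d\<close>, \<open>s p $ \<gamma> $ i\<close> is the coefficient of
  \<open>dz\<^sup>\<gamma> \<otimes> e\<^sub>i\<close> of a section \<open>s\<close>; \<open>f\<^sup>*TN\<close> is complexified.\<close>

definition coord_f :: "('b, real^'n) chart \<Rightarrow> ('a \<Rightarrow> 'b) \<Rightarrow> 'n \<Rightarrow> 'a \<Rightarrow> complex" where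
  "coord_f d f i p = complex_of_real (cmap d (f p) $ i)"

definition del_map ::
  "('a, complex^'m) chart \<Rightarrow> ('b, real^'n) chart \<Rightarrow> ('a \<Rightarrow> 'b) \<Rightarrow> 'a \<Rightarrow> complex^'n^'m" where
  "del_map c d f p = (\<chi> \<alpha> i. pdz c \<alpha> (coord_f d f i) p)"

definition ip_F :: "complex^'m^'m \<Rightarrow> real^'n^'n \<Rightarrow> complex^'n^'m \<Rightarrow> complex^'n^'m \<Rightarrow> complex" where
  "ip_F H G s t = (\<Sum>\<gamma>\<in>UNIV. \<Sum>\<delta>\<in>UNIV. \<Sum>i\<in>UNIV. \<Sum>j\<in>UNIV.
     upper H \<gamma> \<delta> * complex_of_real (G $ i $ j) * s $ \<gamma> $ i * cnj (t $ \<delta> $ j))"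

text \<open>The connection induced on the tensor product by the dual of the Chern connection and the
  pull-back of the Levi-Civita connection, along a real tangent vector \<open>v\<close>.\<close>

definition nabla_F ::
  "(('a, complex^'m) chart \<Rightarrow> 'a \<Rightarrow> complex^'m^'m) \<Rightarrow> ('a, complex^'m) chart
    \<Rightarrow> (('b, real^'n) chart \<Rightarrow> 'b \<Rightarrow> real^'n^'n) \<Rightarrow> ('b, real^'n) chart
    \<Rightarrow> ('a \<Rightarrow> 'b) \<Rightarrow> ('a \<Rightarrow> complex^'n^'m) \<Rightarrow> complex^'m \<Rightarrow> 'a \<Rightarrow> complex^'n^'m" where
  "nabla_F h c g d f s v p = (\<chi> \<gamma> i.
     dirD c (\<lambda>q. s q $ \<gamma> $ i) v p
     - (\<Sum>\<alpha>\<in>UNIV. \<Sum>\<mu>\<in>UNIV. v $ \<alpha> * chern h c \<mu> \<alpha> \<gamma> p * s p $ \<mu> $ i)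
     + (\<Sum>j\<in>UNIV. \<Sum>k\<in>UNIV. complex_of_real (christoffel g d i j k (f p))
          * dirD c (coord_f d f j) v p * s p $ \<gamma> $ k))"

text \<open>The (1,0)-part \<open>dz\<^sup>\<alpha> \<otimes> \<nabla>\<^sub>\<alpha> s\<close>, given by its coefficients \<open>\<alpha> \<mapsto> \<nabla>\<^sub>\<alpha> s\<close>.\<close>

definition del_F ::
  "(('a, complex^'m) chart \<Rightarrow> 'a \<Rightarrow> complex^'m^'m) \<Rightarrow> ('a, complex^'m) chart
    \<Rightarrow> (('b, real^'n) chart \<Rightarrow> 'b \<Rightarrow> real^'n^'n) \<Rightarrow> ('b, real^'n) chart
    \<Rightarrow> ('a \<Rightarrow> 'b) \<Rightarrow> ('a \<Rightarrow> complex^'n^'m) \<Rightarrow> 'a \<Rightarrow> 'm \<Rightarrow> complex^'n^'m" where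
  "del_F h c g d f s p \<alpha> = (\<chi> \<gamma> i. coeff10 (\<lambda>v. nabla_F h c g d f s v p $ \<gamma> $ i) \<alpha>)"

text \<open>For (1,0)-forms \<open>dz\<^sup>\<alpha> \<otimes> \<Phi>\<^sub>\<alpha>\<close> and \<open>dz\<^sup>\<beta> \<otimes> \<Psi>\<^sub>\<beta>\<close> with values in the bundle.\<close>

definition bracket_F ::
  "complex^'m^'m \<Rightarrow> real^'n^'n \<Rightarrow> ('m \<Rightarrow> complex^'n^'m) \<Rightarrow> ('m \<Rightarrow> complex^'n^'m)
    \<Rightarrow> complex^'m \<Rightarrow> complex^'m \<Rightarrow> complex" where
  "bracket_F H G \<Phi> \<Psi> = form11 (\<lambda>\<alpha> \<beta>. ip_F H G (\<Phi> \<alpha>) (\<Psi> \<beta>))"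

section \<open>Energy density and pluri-harmonic maps\<close>

text \<open>\<open>|\<partial>f|\<^sup>2\<close> is computed in arbitrarily chosen charts around \<open>p\<close> and \<open>f p\<close>; lemma
  \<open>energy_density_eq\<close> below shows that the choice is irrelevant. It is real, but kept as a complex
  number because it is fed to the complex operators.\<close>

definition chart_at :: "('a, 'e) chart set \<Rightarrow> 'a \<Rightarrow> ('a, 'e) chart" where
  "chart_at A p = (SOME c. c \<in> A \<and> p \<in> cdom c)"

definition energy_density ::
  "('a, complex^'m) chart set \<Rightarrow> (('a, complex^'m) chart \<Rightarrow> 'a \<Rightarrow> complex^'m^'m)
    \<Rightarrow> ('b, real^'n) chart set \<Rightarrow> (('b, real^'n) chart \<Rightarrow> 'b \<Rightarrow> real^'n^'n)
    \<Rightarrow> ('a \<Rightarrow> 'b) \<Rightarrow> 'a \<Rightarrow> complex" where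
  "energy_density A h B g f p =
     (let c = chart_at A p; d = chart_at B (f p)
      in ip_F (h c p) (g d (f p)) (del_map c d f p) (del_map c d f p))"

definition pluriharmonic ::
  "('a, complex^'m) chart set \<Rightarrow> ('b, real^'n) chart set
    \<Rightarrow> (('b, real^'n) chart \<Rightarrow> 'b \<Rightarrow> real^'n^'n) \<Rightarrow> ('a \<Rightarrow> 'b) \<Rightarrow> bool" where
  "pluriharmonic A B g f \<longleftrightarrow>
     (\<forall>c\<in>A. \<forall>d\<in>B. \<forall>p\<in>cdom c \<inter> f -` cdom d. \<forall>i v w.
        form11 (\<lambda>\<alpha> \<beta>. pdz c \<alpha> (pdzbar c \<beta> (coord_f d f i)) p
          + (\<Sum>j\<in>UNIV. \<Sum>k\<in>UNIV. complex_of_real (christoffel g d i j k (f p))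
               * pdzbar c \<beta> (coord_f d f j) p * pdz c \<alpha> (coord_f d f k) p)) v w = 0)"

section \<open>Characteristic properties of the connections; the energy density is well defined\<close>

lemma invertible_hermitian:
  fixes H :: "complex^'m^'m"
  assumes pos: "\<And>v. v \<noteq> 0 \<Longrightarrow>
      Re (\<Sum>\<alpha>\<in>UNIV. \<Sum>\<beta>\<in>UNIV. H $ \<alpha> $ \<beta> * v $ \<alpha> * cnj (v $ \<beta>)) > 0"
  shows "invertible H"
proof -
  have "x = 0" if x: "H *v x = 0" for x
  proof (rule ccontr)
    assume "x \<noteq> 0"
    define v :: "complex^'m" where "v = (\<chi> i. cnj (x $ i))"
    have "v \<noteq> 0" using \<open>x \<noteq> 0\<close> by (auto simp: v_def vec_eq_iff)
    have "(\<Sum>\<alpha>\<in>UNIV. \<Sum>\<beta>\<in>UNIV. H $ \<alpha> $ \<beta> * v $ \<alpha> * cnj (v $ \<beta>))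
        = (\<Sum>\<alpha>\<in>UNIV. cnj (x $ \<alpha>) * ((H *v x) $ \<alpha>))"
      by (simp add: v_def matrix_vector_mult_def sum_distrib_left algebra_simps)
    also have "\<dots> = 0" using x by simp
    finally show False using pos[OF \<open>v \<noteq> 0\<close>] by simp
  qed
  then have "\<exists>B. B ** H = mat 1" by (simp add: matrix_left_invertible_ker)
  then show ?thesis by (simp add: invertible_left_inverse)
qed

lemma invertible_riemannian:
  fixes G :: "real^'n^'n"
  assumes pos: "\<And>v. v \<noteq> 0 \<Longrightarrow> (\<Sum>i\<in>UNIV. \<Sum>j\<in>UNIV. G $ i $ j * v $ i * v $ j) > 0"
  shows "invertible G"
proof -
  have "x = 0" if x: "G *v x = 0" for x
  proof (rule ccontr)
    assume "x \<noteq> 0"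
    have "(\<Sum>i\<in>UNIV. \<Sum>j\<in>UNIV. G $ i $ j * x $ i * x $ j)
        = (\<Sum>i\<in>UNIV. x $ i * ((G *v x) $ i))"
      by (simp add: matrix_vector_mult_def sum_distrib_left algebra_simps)
    also have "\<dots> = 0" using x by simp
    finally show False using pos[OF \<open>x \<noteq> 0\<close>] by simp
  qed
  then have "\<exists>B. B ** G = mat 1" by (simp add: matrix_left_invertible_ker)
  then show ?thesis by (simp add: invertible_left_inverse)
qed

lemma matrix_inv_works:
  fixes H :: "'k::field^'m^'m"
  assumes "invertible H"
  shows "H ** matrix_inv H = mat 1" "matrix_inv H ** H = mat 1"
proof -
  have "\<exists>A'. H ** A' = mat 1 \<and> A' ** H = mat 1" using assms by (simp add: invertible_def)
  then have "H ** matrix_inv H = mat 1 \<and> matrix_inv H ** H = mat 1"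
    unfolding matrix_inv_def by (rule someI_ex)
  then show "H ** matrix_inv H = mat 1" "matrix_inv H ** H = mat 1" by auto
qed

lemma upper_inverse:
  fixes H :: "'k::field^'m^'m"
  assumes "invertible H"
  shows "(\<Sum>\<beta>\<in>UNIV. upper H \<alpha> \<beta> * H $ \<gamma> $ \<beta>) = (if \<gamma> = \<alpha> then 1 else 0)"
    and "(\<Sum>\<alpha>\<in>UNIV. upper H \<alpha> \<beta> * H $ \<alpha> $ \<delta>) = (if \<beta> = \<delta> then 1 else 0)"
  using matrix_inv_works[OF assms]
  by (simp_all add: upper_def matrix_matrix_mult_def mat_def vec_eq_iff mult.commute)

lemma chern_metric:
  assumes "hermitian_metric A h" "c \<in> A" "p \<in> cdom c"
  shows "pdz c \<alpha> (\<lambda>q. h c q $ \<gamma> $ \<delta>) p = (\<Sum>\<mu>\<in>UNIV. chern h c \<mu> \<alpha> \<gamma> p * h c p $ \<mu> $ \<delta>)"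
proof -
  have inv: "invertible (h c p)"
    using conjunct1[OF iffD1[OF hermitian_metric_def assms(1)]] assms(2,3)
    by (intro invertible_hermitian) blast
  have "(\<Sum>\<mu>\<in>UNIV. chern h c \<mu> \<alpha> \<gamma> p * h c p $ \<mu> $ \<delta>)
      = (\<Sum>\<mu>\<in>UNIV. \<Sum>\<nu>\<in>UNIV. pdz c \<alpha> (\<lambda>q. h c q $ \<gamma> $ \<nu>) p * (upper (h c p) \<mu> \<nu> * h c p $ \<mu> $ \<delta>))"
    unfolding chern_def sum_distrib_right by (simp add: mult_ac)
  also have "\<dots> = (\<Sum>\<nu>\<in>UNIV. pdz c \<alpha> (\<lambda>q. h c q $ \<gamma> $ \<nu>) p
        * (\<Sum>\<mu>\<in>UNIV. upper (h c p) \<mu> \<nu> * h c p $ \<mu> $ \<delta>))"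
    by (subst sum.swap) (simp add: sum_distrib_left)
  also have "\<dots> = pdz c \<alpha> (\<lambda>q. h c q $ \<gamma> $ \<delta>) p"
    by (simp add: upper_inverse[OF inv] if_distrib cong: if_cong)
  finally show ?thesis by simp
qed

lemma pdy_cong:
  assumes d: "open (cmap d ` cdom d)" "inj_on (cmap d) (cdom d)" "q \<in> cdom d"
    and eq: "\<And>x. x \<in> cdom d \<Longrightarrow> F x = G x"
  shows "pdy d k F q = pdy d k G q"
proof -
  have FG: "(F \<circ> cinv d) y = (G \<circ> cinv d) y" if "y \<in> cmap d ` cdom d" for y
    using that d(2) eq by (auto simp: cinv_def)
  have "(F \<circ> cinv d has_derivative D) (at (cmap d q)) \<longleftrightarrow> (G \<circ> cinv d has_derivative D) (at (cmap d q))"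
    for D
  proof
    assume "(F \<circ> cinv d has_derivative D) (at (cmap d q))"
    then show "(G \<circ> cinv d has_derivative D) (at (cmap d q))"
      by (rule has_derivative_transform_within_open[OF _ d(1)]) (use d(3) FG in auto)
  next
    assume "(G \<circ> cinv d has_derivative D) (at (cmap d q))"
    then show "(F \<circ> cinv d has_derivative D) (at (cmap d q))"
      by (rule has_derivative_transform_within_open[OF _ d(1)]) (use d(3) FG in auto)
  qed
  then show ?thesis by (simp add: pdy_def dirD_def frechet_derivative_def)
qed

lemma atlas_chart:
  assumes "atlas P A" "c \<in> A"
  shows "open (cdom c)" "open (cmap c ` cdom c)" "inj_on (cmap c) (cdom c)"
    "\<And>x. x \<in> cdom c \<Longrightarrow> cinv c (cmap c x) = x"
    "\<And>S. open S \<Longrightarrow> open (cmap c ` (cdom c \<inter> S))"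
    "homeomorphism (cdom c) (cmap c ` cdom c) (cmap c) (cinv c)"
proof -
  show 1: "open (cdom c)" and 2: "open (cmap c ` cdom c)"
    and 3: "homeomorphism (cdom c) (cmap c ` cdom c) (cmap c) (cinv c)"
    using assms by (auto simp: atlas_def)
  show 4: "\<And>x. x \<in> cdom c \<Longrightarrow> cinv c (cmap c x) = x"
    using 3 by (auto simp: homeomorphism_def)
  then show "inj_on (cmap c) (cdom c)" by (metis inj_onI)
  fix S :: "'b set" assume "open S"
  then have "openin (top_of_set (cmap c ` cdom c)) (cmap c ` (cdom c \<inter> S))"
    by (intro homeomorphism_imp_open_map[OF 3]) auto
  then show "open (cmap c ` (cdom c \<inter> S))" using 2 by (simp add: openin_open_eq)
qed

lemma riemannian_sym_deriv:
  assumes "riemannian_manifold B g" "d \<in> B" "q \<in> cdom d"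
  shows "pdy d k (\<lambda>x. g d x $ i $ j) q = pdy d k (\<lambda>x. g d x $ j $ i) q"
proof (rule pdy_cong)
  have "atlas smooth_on B" using assms by (simp add: riemannian_manifold_def)
  from atlas_chart[OF this assms(2)]
  show "open (cmap d ` cdom d)" "inj_on (cmap d) (cdom d)" by auto
qed (use assms in \<open>auto simp: riemannian_manifold_def riemannian_metric_def\<close>)

lemma levi_civita_torsion_free:
  assumes "riemannian_manifold B g" "d \<in> B" "q \<in> cdom d"
  shows "christoffel g d i j k q = christoffel g d i k j q"
  unfolding christoffel_def using riemannian_sym_deriv[OF assms]
  by (intro arg_cong2[of _ _ _ _ "(*)"] sum.cong refl) (metis add.commute)

lemma christoffel_lower:
  assumes "riemannian_manifold B g" "d \<in> B" "q \<in> cdom d"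
  shows "(\<Sum>i\<in>UNIV. christoffel g d i j k q * g d q $ i $ m) =
    (pdy d j (\<lambda>x. g d x $ k $ m) q + pdy d k (\<lambda>x. g d x $ j $ m) q - pdy d m (\<lambda>x. g d x $ j $ k) q) / 2"
proof -
  have inv: "invertible (g d q)"
    using assms by (intro invertible_riemannian) (auto simp: riemannian_manifold_def riemannian_metric_def)
  define E where "E l = pdy d j (\<lambda>x. g d x $ k $ l) q + pdy d k (\<lambda>x. g d x $ j $ l) q
      - pdy d l (\<lambda>x. g d x $ j $ k) q" for l
  have "(\<Sum>i\<in>UNIV. christoffel g d i j k q * g d q $ i $ m)
      = (\<Sum>i\<in>UNIV. \<Sum>l\<in>UNIV. E l / 2 * (upper (g d q) i l * g d q $ i $ m))"
    by (simp add: christoffel_def E_def[symmetric] sum_distrib_left sum_distrib_right sum_divide_distrib mult_ac)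
  also have "\<dots> = (\<Sum>l\<in>UNIV. E l / 2 * (\<Sum>i\<in>UNIV. upper (g d q) i l * g d q $ i $ m))"
    by (subst sum.swap) (simp only: sum_distrib_left)
  also have "\<dots> = E m / 2" by (simp add: upper_inverse[OF inv] if_distrib cong: if_cong)
  finally show ?thesis by (simp add: E_def)
qed

lemma levi_civita_metric:
  assumes "riemannian_manifold B g" "d \<in> B" "q \<in> cdom d"
  shows "pdy d k (\<lambda>x. g d x $ i $ j) q =
    (\<Sum>l\<in>UNIV. christoffel g d l k i q * g d q $ l $ j) + (\<Sum>l\<in>UNIV. christoffel g d l k j q * g d q $ l $ i)"
  using riemannian_sym_deriv[OF assms, of k i j] riemannian_sym_deriv[OF assms, of i j k]
    riemannian_sym_deriv[OF assms, of j i k]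
  unfolding christoffel_lower[OF assms] by (simp add: add_divide_distrib diff_divide_distrib)

lemma clinear_coeff10:
  fixes J :: "complex^'m \<Rightarrow> complex^'k"
  assumes J: "bounded_linear J" "\<And>a v. J (a *s v) = a *s J v" and T: "bounded_linear T"
  shows "coeff10 (\<lambda>v. T (J v)) \<alpha> = (\<Sum>\<mu>\<in>UNIV. J (axis \<alpha> 1) $ \<mu> * coeff10 T \<mu>)"
proof -
  interpret T: bounded_linear T by fact
  have T_expand: "T w = (\<Sum>\<mu>\<in>UNIV. of_real (Re (w $ \<mu>)) * T (axis \<mu> 1)
      + of_real (Im (w $ \<mu>)) * T (axis \<mu> \<i>))" for w
  proof -
    have "w = (\<Sum>\<mu>\<in>UNIV. Re (w $ \<mu>) *\<^sub>R axis \<mu> 1 + Im (w $ \<mu>) *\<^sub>R axis \<mu> \<i>)"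
      by (auto simp: vec_eq_iff sum.distrib axis_def if_distrib sum.delta complex_eq_iff cong: if_cong)
    then have "T w = T (\<Sum>\<mu>\<in>UNIV. Re (w $ \<mu>) *\<^sub>R axis \<mu> 1 + Im (w $ \<mu>) *\<^sub>R axis \<mu> \<i>)"
      by simp
    also have "\<dots> = (\<Sum>\<mu>\<in>UNIV. of_real (Re (w $ \<mu>)) * T (axis \<mu> 1)
      + of_real (Im (w $ \<mu>)) * T (axis \<mu> \<i>))"
      unfolding T.sum T.add T.scaleR by (simp add: scaleR_conv_of_real)
    finally show ?thesis .
  qed
  have i: "axis \<alpha> \<i> = \<i> *s axis \<alpha> (1::complex)" by (auto simp: vec_eq_iff axis_def)
  have *: "(of_real (Re w) * a + of_real (Im w) * b)
      - \<i> * (of_real (Re (\<i> * w)) * a + of_real (Im (\<i> * w)) * b) = w * (a - \<i> * b)" for w a b :: complex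
    by (auto simp: complex_eq_iff algebra_simps)
  define w where "w = J (axis \<alpha> 1)"
  have "coeff10 (\<lambda>v. T (J v)) \<alpha> = (T w - \<i> * T (\<i> *s w)) / 2"
    by (simp add: coeff10_def i J(2) w_def)
  also have "\<dots> = (\<Sum>\<mu>\<in>UNIV. w $ \<mu> * (T (axis \<mu> 1) - \<i> * T (axis \<mu> \<i>))) / 2"
    unfolding T_expand[of w] T_expand[of "\<i> *s w"]
    by (simp only: sum_distrib_left sum_subtractf[symmetric] vector_smult_component *)
  also have "\<dots> = (\<Sum>\<mu>\<in>UNIV. J (axis \<alpha> 1) $ \<mu> * coeff10 T \<mu>)"
    by (simp add: coeff10_def w_def sum_divide_distrib)
  finally show ?thesis .
qed

lemma upper_transform:
  fixes H H' J :: "complex^'m^'m"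
  assumes inv: "invertible H"
    and law: "\<And>\<alpha> \<beta>. H $ \<alpha> $ \<beta> = (\<Sum>\<mu>\<in>UNIV. \<Sum>\<nu>\<in>UNIV. H' $ \<mu> $ \<nu> * J $ \<mu> $ \<alpha> * cnj (J $ \<nu> $ \<beta>))"
  shows "upper H' \<mu> \<nu> = (\<Sum>\<alpha>\<in>UNIV. \<Sum>\<beta>\<in>UNIV. upper H \<alpha> \<beta> * J $ \<mu> $ \<alpha> * cnj (J $ \<nu> $ \<beta>))"
proof -
  define K where "K = (\<chi> \<nu> \<beta>. cnj (J $ \<nu> $ \<beta>))"
  have "H = transpose J ** (H' ** K)"
    by (auto simp: vec_eq_iff matrix_matrix_mult_def transpose_def K_def law sum_distrib_left mult_ac
        intro!: sum.cong)
  then have "transpose J ** (H' ** K ** matrix_inv H) = mat 1"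
    using matrix_inv_works(1)[OF inv] by (simp add: matrix_mul_assoc)
  then have "(H' ** K ** matrix_inv H) ** transpose J = mat 1"
    by (simp add: matrix_left_right_inverse)
  then have r: "H' ** (K ** matrix_inv H ** transpose J) = mat 1"
    by (simp add: matrix_mul_assoc)
  then have "invertible H'"
    by (meson invertible_def matrix_left_right_inverse)
  then have "matrix_inv H' = K ** matrix_inv H ** transpose J"
    using r by (metis matrix_inv_works(2) matrix_mul_assoc matrix_mul_lid matrix_mul_rid)
  then have "upper H' \<mu> \<nu> = (\<Sum>\<alpha>\<in>UNIV. \<Sum>\<beta>\<in>UNIV. K $ \<nu> $ \<beta> * matrix_inv H $ \<beta> $ \<alpha> * J $ \<mu> $ \<alpha>)"
    by (simp add: upper_def matrix_matrix_mult_def transpose_def sum_distrib_right)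
  then show ?thesis by (simp add: upper_def K_def mult_ac)
qed

lemma sum_Times: "(\<Sum>x\<in>A \<times> B. F x) = (\<Sum>a\<in>A. \<Sum>b\<in>B. F (a, b))"
  by (simp add: sum.cartesian_product case_prod_unfold)

lemma sum_swap4:
  "(\<Sum>a\<in>A. \<Sum>b\<in>B. \<Sum>c\<in>C. \<Sum>e\<in>E. F a b c e) = (\<Sum>c\<in>C. \<Sum>e\<in>E. \<Sum>a\<in>A. \<Sum>b\<in>B. F a b c e)"
proof -
  have "(\<Sum>x\<in>A \<times> B. \<Sum>y\<in>C \<times> E. F (fst x) (snd x) (fst y) (snd y))
      = (\<Sum>y\<in>C \<times> E. \<Sum>x\<in>A \<times> B. F (fst x) (snd x) (fst y) (snd y))"
    by (rule sum.swap)
  then show ?thesis by (simp add: sum_Times)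
qed

lemma ip_F_transform:
  fixes s s' :: "complex^'n^'m"
  assumes inv: "invertible H"
    and H: "\<And>\<alpha> \<beta>. H $ \<alpha> $ \<beta> = (\<Sum>\<mu>\<in>UNIV. \<Sum>\<nu>\<in>UNIV. H' $ \<mu> $ \<nu> * J $ \<mu> $ \<alpha> * cnj (J $ \<nu> $ \<beta>))"
    and G: "\<And>k l. G' $ k $ l = (\<Sum>i\<in>UNIV. \<Sum>j\<in>UNIV. G $ i $ j * S $ i $ k * S $ j $ l)"
    and s: "\<And>\<alpha> i. s $ \<alpha> $ i = (\<Sum>\<mu>\<in>UNIV. \<Sum>k\<in>UNIV. J $ \<mu> $ \<alpha> * of_real (S $ i $ k) * s' $ \<mu> $ k)"
  shows "ip_F H G s s = ip_F H' G' s' s'"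
proof -
  define t where "t \<alpha> k = (\<Sum>\<mu>\<in>UNIV. J $ \<mu> $ \<alpha> * s' $ \<mu> $ k)" for \<alpha> k
  have st: "s $ \<alpha> $ i = (\<Sum>k\<in>UNIV. of_real (S $ i $ k) * t \<alpha> k)" for \<alpha> i
    unfolding s t_def sum_distrib_left by (subst sum.swap) (simp add: mult_ac)
  have 1: "(\<Sum>i\<in>UNIV. \<Sum>j\<in>UNIV. U * of_real (G $ i $ j) * s $ \<gamma> $ i * cnj (s $ \<delta> $ j))
     = (\<Sum>k\<in>UNIV. \<Sum>l\<in>UNIV. U * of_real (G' $ k $ l) * t \<gamma> k * cnj (t \<delta> l))" for U \<gamma> \<delta>
  proof -
    have "(\<Sum>i\<in>UNIV. \<Sum>j\<in>UNIV. U * of_real (G $ i $ j) * s $ \<gamma> $ i * cnj (s $ \<delta> $ j))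
      = (\<Sum>i\<in>UNIV. \<Sum>j\<in>UNIV. \<Sum>k\<in>UNIV. \<Sum>l\<in>UNIV.
          U * of_real (G $ i $ j * S $ i $ k * S $ j $ l) * t \<gamma> k * cnj (t \<delta> l))"
      by (simp add: st sum_distrib_left sum_distrib_right mult_ac)
    also have "\<dots> = (\<Sum>k\<in>UNIV. \<Sum>l\<in>UNIV. \<Sum>i\<in>UNIV. \<Sum>j\<in>UNIV.
          U * of_real (G $ i $ j * S $ i $ k * S $ j $ l) * t \<gamma> k * cnj (t \<delta> l))"
      by (rule sum_swap4)
    also have "\<dots> = (\<Sum>k\<in>UNIV. \<Sum>l\<in>UNIV. U * of_real (G' $ k $ l) * t \<gamma> k * cnj (t \<delta> l))"
      by (simp add: G sum_distrib_left sum_distrib_right)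
    finally show ?thesis .
  qed
  have 2: "(\<Sum>\<gamma>\<in>UNIV. \<Sum>\<delta>\<in>UNIV. upper H \<gamma> \<delta> * X * t \<gamma> k * cnj (t \<delta> l))
     = (\<Sum>\<mu>\<in>UNIV. \<Sum>\<nu>\<in>UNIV. upper H' \<mu> \<nu> * X * s' $ \<mu> $ k * cnj (s' $ \<nu> $ l))" for X k l
  proof -
    have "(\<Sum>\<gamma>\<in>UNIV. \<Sum>\<delta>\<in>UNIV. upper H \<gamma> \<delta> * X * t \<gamma> k * cnj (t \<delta> l))
      = (\<Sum>\<gamma>\<in>UNIV. \<Sum>\<delta>\<in>UNIV. \<Sum>\<mu>\<in>UNIV. \<Sum>\<nu>\<in>UNIV.
          (upper H \<gamma> \<delta> * J $ \<mu> $ \<gamma> * cnj (J $ \<nu> $ \<delta>)) * X * s' $ \<mu> $ k * cnj (s' $ \<nu> $ l))"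
      by (simp add: t_def sum_distrib_left sum_distrib_right mult_ac)
    also have "\<dots> = (\<Sum>\<mu>\<in>UNIV. \<Sum>\<nu>\<in>UNIV. \<Sum>\<gamma>\<in>UNIV. \<Sum>\<delta>\<in>UNIV.
          (upper H \<gamma> \<delta> * J $ \<mu> $ \<gamma> * cnj (J $ \<nu> $ \<delta>)) * X * s' $ \<mu> $ k * cnj (s' $ \<nu> $ l))"
      by (rule sum_swap4)
    also have "\<dots> = (\<Sum>\<mu>\<in>UNIV. \<Sum>\<nu>\<in>UNIV. upper H' \<mu> \<nu> * X * s' $ \<mu> $ k * cnj (s' $ \<nu> $ l))"
      by (simp add: upper_transform[OF inv H] sum_distrib_right)
    finally show ?thesis .
  qed
  have "ip_F H G s s = (\<Sum>\<gamma>\<in>UNIV. \<Sum>\<delta>\<in>UNIV. \<Sum>k\<in>UNIV. \<Sum>l\<in>UNIV.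
      upper H \<gamma> \<delta> * of_real (G' $ k $ l) * t \<gamma> k * cnj (t \<delta> l))"
    by (simp add: ip_F_def 1)
  also have "\<dots> = (\<Sum>k\<in>UNIV. \<Sum>l\<in>UNIV. \<Sum>\<gamma>\<in>UNIV. \<Sum>\<delta>\<in>UNIV.
      upper H \<gamma> \<delta> * of_real (G' $ k $ l) * t \<gamma> k * cnj (t \<delta> l))"
    by (rule sum_swap4)
  also have "\<dots> = (\<Sum>k\<in>UNIV. \<Sum>l\<in>UNIV. \<Sum>\<mu>\<in>UNIV. \<Sum>\<nu>\<in>UNIV.
      upper H' \<mu> \<nu> * of_real (G' $ k $ l) * s' $ \<mu> $ k * cnj (s' $ \<nu> $ l))"
    by (simp only: 2)
  also have "\<dots> = ip_F H' G' s' s'" unfolding ip_F_def by (rule sum_swap4)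
  finally show ?thesis .
qed

lemma smooth_on_differentiable: "smooth_on F S \<Longrightarrow> x \<in> S \<Longrightarrow> F differentiable (at x)"
  unfolding smooth_on_def using Ck_on.simps(2)[of 0 F S] by blast

lemma del_map_transform:
  assumes A: "complex_atlas A" and B: "smooth_atlas B" and f: "smooth_map A B f"
    and c: "c \<in> A" "p \<in> cdom c" and c': "c' \<in> A" "p \<in> cdom c'"
    and d: "d \<in> B" "f p \<in> cdom d" and d': "d' \<in> B" "f p \<in> cdom d'"
  shows "del_map c d f p $ \<alpha> $ i = (\<Sum>\<mu>\<in>UNIV. \<Sum>k\<in>UNIV.
    pdz c \<alpha> (\<lambda>q. cmap c' q $ \<mu>) p * of_real (pdy d' k (\<lambda>x. cmap d x $ i) (f p)) * del_map c' d' f p $ \<mu> $ k)"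
proof -
  note Ac = atlas_chart[OF A c(1)] and Ac' = atlas_chart[OF A c'(1)]
    and Bd = atlas_chart[OF B d(1)] and Bd' = atlas_chart[OF B d'(1)]
  have "holomorphic_map_on (cmap c' \<circ> cinv c) (cmap c ` (cdom c \<inter> cdom c'))"
    using A c c' by (auto simp: atlas_def)
  then obtain J where J: "(cmap c' \<circ> cinv c has_derivative J) (at (cmap c p))"
    and Jlin: "\<And>a v. J (a *s v) = a *s J v"
    using c c' by (force simp: holomorphic_map_on_def)
  have "(cmap d' \<circ> f \<circ> cinv c') differentiable (at (cmap c' p))"
    using f c' d' by (intro smooth_on_differentiable[of _ "cmap c' ` (cdom c' \<inter> f -` cdom d')"])
      (auto simp: smooth_map_def)
  then obtain P where P: "(cmap d' \<circ> f \<circ> cinv c' has_derivative P) (at (cmap c' p))"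
    by (auto simp: differentiable_def)
  have "(cmap d \<circ> cinv d') differentiable (at (cmap d' (f p)))"
    using B d d' by (intro smooth_on_differentiable[of _ "cmap d' ` (cdom d' \<inter> cdom d)"])
      (auto simp: atlas_def)
  then obtain Q where Q: "(cmap d \<circ> cinv d' has_derivative Q) (at (cmap d' (f p)))"
    by (auto simp: differentiable_def)
  have bl: "bounded_linear J" "bounded_linear P" "bounded_linear Q"
    using J P Q by (auto intro: has_derivative_bounded_linear)

  have J_comp: "pdz c \<alpha> (\<lambda>q. cmap c' q $ \<mu>) p = J (axis \<alpha> 1) $ \<mu>" for \<mu>
  proof -
    have "((\<lambda>q. cmap c' q $ \<mu>) \<circ> cinv c has_derivative (\<lambda>v. J v $ \<mu>)) (at (cmap c p))"
      using bounded_linear.has_derivative[OF bounded_linear_vec_nth J] by (simp add: o_def)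
    then have "dirD c (\<lambda>q. cmap c' q $ \<mu>) v p = J v $ \<mu>" for v
      unfolding dirD_def using frechet_derivative_at by metis
    moreover have "axis \<alpha> \<i> = \<i> *s axis \<alpha> (1::complex)" by (auto simp: vec_eq_iff axis_def)
    ultimately show ?thesis by (simp add: pdz_def coeff10_def Jlin)
  qed
  have Q_comp: "pdy d' k (\<lambda>x. cmap d x $ i) (f p) = Q (axis k 1) $ i" for k
  proof -
    have "((\<lambda>x. cmap d x $ i) \<circ> cinv d' has_derivative (\<lambda>v. Q v $ i)) (at (cmap d' (f p)))"
      using bounded_linear.has_derivative[OF bounded_linear_vec_nth Q] by (simp add: o_def)
    then show ?thesis
      unfolding dirD_def pdy_def using frechet_derivative_at by metis
  qed
  have Q_expand: "Q y $ i = (\<Sum>k\<in>UNIV. Q (axis k 1) $ i * y $ k)" for y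
  proof -
    have "y = (\<Sum>k\<in>UNIV. (y $ k) *\<^sub>R axis k 1)"
      by (simp add: vec_eq_iff axis_def if_distrib cong: if_cong)
    then have "Q y $ i = Q (\<Sum>k\<in>UNIV. (y $ k) *\<^sub>R axis k 1) $ i" by simp
    also have "\<dots> = (\<Sum>k\<in>UNIV. Q (axis k 1) $ i * y $ k)"
      using bl(3) by (simp add: linear_sum[OF bounded_linear.linear] linear_scale[OF bounded_linear.linear] mult.commute)
    finally show ?thesis .
  qed
  have P_comp: "del_map c' d' f p $ \<mu> $ k = coeff10 (\<lambda>v. of_real (P v $ k)) \<mu>" for \<mu> k
  proof -
    have "(coord_f d' f k \<circ> cinv c' has_derivative (\<lambda>v. of_real (P v $ k))) (at (cmap c' p))"
      using bounded_linear.has_derivative[OF bounded_linear_of_real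
          bounded_linear.has_derivative[OF bounded_linear_vec_nth P]]
      by (simp add: o_def coord_f_def)
    then have "dirD c' (coord_f d' f k) v p = of_real (P v $ k)" for v
      unfolding dirD_def using frechet_derivative_at by metis
    then show ?thesis by (simp add: del_map_def pdz_def)
  qed

  define U where "U = cmap c ` (cdom c \<inter> (cdom c' \<inter> f -` (cdom d \<inter> cdom d')))"
  have "open (f -` (cdom d \<inter> cdom d'))"
    using f Bd(1) Bd'(1) by (intro open_vimage) (auto simp: smooth_map_def)
  then have oU: "open U" unfolding U_def by (intro Ac(5)) (auto intro: Ac'(1))
  have "((cmap d \<circ> cinv d') \<circ> ((cmap d' \<circ> f \<circ> cinv c') \<circ> (cmap c' \<circ> cinv c))
      has_derivative (\<lambda>v. Q (P (J v)))) (at (cmap c p))"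
    using diff_chain_at[OF diff_chain_at[OF J, of "cmap d' \<circ> f \<circ> cinv c'" P], of "cmap d \<circ> cinv d'" Q]
      P Q by (simp add: o_def Ac(4)[OF c(2)] Ac'(4)[OF c'(2)])
  then have "(cmap d \<circ> f \<circ> cinv c has_derivative (\<lambda>v. Q (P (J v)))) (at (cmap c p))"
  proof (rule has_derivative_transform_within_open[OF _ oU])
    show "cmap c p \<in> U" using c c' d d' by (auto simp: U_def)
  qed (auto simp: U_def Ac(4) Ac'(4) Bd'(4))
  from bounded_linear.has_derivative[OF bounded_linear_of_real
      bounded_linear.has_derivative[OF bounded_linear_vec_nth this]]
  have "(coord_f d f i \<circ> cinv c has_derivative (\<lambda>v. of_real (Q (P (J v)) $ i))) (at (cmap c p))"
    by (simp add: o_def coord_f_def)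
  then have "dirD c (coord_f d f i) v p = of_real (Q (P (J v)) $ i)" for v
    unfolding dirD_def using frechet_derivative_at by metis
  then have "del_map c d f p $ \<alpha> $ i = coeff10 (\<lambda>v. of_real (Q (P (J v)) $ i)) \<alpha>"
    by (simp add: del_map_def pdz_def)
  also have "\<dots> = (\<Sum>\<mu>\<in>UNIV. J (axis \<alpha> 1) $ \<mu> * coeff10 (\<lambda>w. of_real (Q (P w) $ i)) \<mu>)"
  proof (rule clinear_coeff10[OF bl(1) Jlin, where T = "\<lambda>w. of_real (Q (P w) $ i)"])
    show "bounded_linear (\<lambda>w. complex_of_real (Q (P w) $ i))"
      using bounded_linear_compose[OF bounded_linear_of_real
          bounded_linear_compose[OF bounded_linear_vec_nth bounded_linear_compose[OF bl(3) bl(2)]]] .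
  qed
  also have "\<dots> = (\<Sum>\<mu>\<in>UNIV. J (axis \<alpha> 1) $ \<mu> *
      (\<Sum>k\<in>UNIV. of_real (Q (axis k 1) $ i) * coeff10 (\<lambda>w. of_real (P w $ k)) \<mu>))"
  proof -
    have "coeff10 (\<lambda>w. complex_of_real (Q (P w) $ i)) \<mu>
        = (\<Sum>k\<in>UNIV. of_real (Q (axis k 1) $ i) * coeff10 (\<lambda>w. of_real (P w $ k)) \<mu>)" for \<mu>
      unfolding coeff10_def
      by (subst (1 2) Q_expand)
        (simp add: sum_distrib_left sum_subtractf sum_divide_distrib algebra_simps diff_divide_distrib)
    then show ?thesis by simp
  qed
  finally show ?thesis
    by (simp add: J_comp Q_comp P_comp sum_distrib_left mult.assoc)
qed

text \<open>The energy density may be computed in any charts.\<close>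

lemma energy_density_eq:
  assumes M: "hermitian_manifold A h" and N: "riemannian_manifold B g" and f: "smooth_map A B f"
    and c: "c \<in> A" "p \<in> cdom c" and d: "d \<in> B" "f p \<in> cdom d"
  shows "energy_density A h B g f p = ip_F (h c p) (g d (f p)) (del_map c d f p) (del_map c d f p)"
proof -
  define c' d' where "c' = chart_at A p" and "d' = chart_at B (f p)"
  have c': "c' \<in> A" "p \<in> cdom c'" and d': "d' \<in> B" "f p \<in> cdom d'"
    unfolding c'_def d'_def chart_at_def
    using someI[of "\<lambda>c. c \<in> A \<and> p \<in> cdom c", OF conjI[OF c]]
      someI[of "\<lambda>d. d \<in> B \<and> f p \<in> cdom d", OF conjI[OF d]] by auto
  have A: "complex_atlas A" and h: "hermitian_metric A h"
    using M by (auto simp: hermitian_manifold_def)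
  have B: "smooth_atlas B" and g: "riemannian_metric B g"
    using N by (auto simp: riemannian_manifold_def)
  define J where "J = (\<chi> \<mu> \<alpha>. pdz c \<alpha> (\<lambda>q. cmap c' q $ \<mu>) p)"
  define S where "S = (\<chi> i k. pdy d' k (\<lambda>x. cmap d x $ i) (f p))"
  have inv: "invertible (h c p)"
    using conjunct1[OF iffD1[OF hermitian_metric_def h]] c by (intro invertible_hermitian) blast
  have Hlaw: "h c p $ \<alpha> $ \<beta> = (\<Sum>\<mu>\<in>UNIV. \<Sum>\<nu>\<in>UNIV. h c' p $ \<mu> $ \<nu> * J $ \<mu> $ \<alpha> * cnj (J $ \<nu> $ \<beta>))"
    for \<alpha> \<beta>
    unfolding J_def vec_lambda_beta
    by (rule conjunct2[OF iffD1[OF hermitian_metric_def h], THEN bspec, OF c(1), THEN bspec, OF c'(1),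
          THEN bspec, OF IntI[OF c(2) c'(2)], THEN spec, THEN spec])
  have Glaw: "g d' (f p) $ k $ l = (\<Sum>i\<in>UNIV. \<Sum>j\<in>UNIV. g d (f p) $ i $ j * S $ i $ k * S $ j $ l)" for k l
    unfolding S_def vec_lambda_beta
    by (rule conjunct2[OF iffD1[OF riemannian_metric_def g], THEN bspec, OF d'(1), THEN bspec, OF d(1),
          THEN bspec, OF IntI[OF d'(2) d(2)], THEN spec, THEN spec])
  have slaw: "del_map c d f p $ \<alpha> $ i =
      (\<Sum>\<mu>\<in>UNIV. \<Sum>k\<in>UNIV. J $ \<mu> $ \<alpha> * of_real (S $ i $ k) * del_map c' d' f p $ \<mu> $ k)" for \<alpha> i
    unfolding J_def S_def vec_lambda_beta by (rule del_map_transform[OF A B f c c' d d'])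
  have "ip_F (h c p) (g d (f p)) (del_map c d f p) (del_map c d f p)
      = ip_F (h c' p) (g d' (f p)) (del_map c' d' f p) (del_map c' d' f p)"
    by (rule ip_F_transform[OF inv Hlaw Glaw slaw])
  then show ?thesis by (simp add: energy_density_def Let_def c'_def d'_def)
qed

end

theory Submission
  imports Defs
begin

text \<open>With respect to the connection of \<open>\<F>\<close>, which is metric, pluri-harmonicity says that the
  section \<open>s = \<partial>f\<close> satisfies \<open>\<nabla>\<^sub>\<beta>' s = 0\<close> in the barred directions. Hence
  \<open>\<partial>\<^sub>\<beta>' u = \<langle>s, \<nabla>\<^sub>\<beta> s\<rangle>\<close> and
  \<open>\<partial>\<^sub>\<alpha> \<partial>\<^sub>\<beta>' u = \<langle>\<nabla>\<^sub>\<alpha> s, \<nabla>\<^sub>\<beta> s\<rangle> + \<langle>s, \<nabla>\<^sub>\<alpha>' \<nabla>\<^sub>\<beta> s\<rangle>\<close>; using \<open>\<nabla>\<^sub>\<alpha>' s = 0\<close> again,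
  the last term is a commutator of covariant derivatives, that is, the curvature of \<open>\<F>\<close>.\<close>

section \<open>Smooth maps and symmetry of second derivatives\<close>

text \<open>The pairing has a conjugated second factor, and the Chern connection form is of type
  (1,0). Hence Chern symbols act only on the first factor under unbarred derivatives, and only on
  the second, conjugated, under barred ones; the Levi-Civita part acts on both factors each time.
  This is why one of the two Chern matrices is zero in each application of the Leibniz rule.
  Products and inverse matrices are differentiated only to first order: the barred derivative of
  \<open>u\<close> is first rewritten, on a whole open set, as a sum of the same shape with
  \<open>s\<close> paired against one covariant derivative, so the second derivative is again a
  single Leibniz rule. Symmetry of second derivatives enters for the components of \<open>g\<close>,
  the coordinates of \<open>f\<close> and the derivatives of these coordinates. The minus sign
  before the curvature of the target comes from antisymmetry in its last two indices, which
  expresses that the Levi-Civita connection is metric.\<close>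

lemma Ck_on_cong:
  assumes "open S" "\<And>x. x \<in> S \<Longrightarrow> F x = G x"
  shows "Ck_on k F S \<longleftrightarrow> Ck_on k G S"
  using assms(2)
proof (induction k arbitrary: F G)
  case 0
  then show ?case by (auto intro!: continuous_on_cong)
next
  case (Suc k)
  have *: "F differentiable (at x) \<longleftrightarrow> G differentiable (at x)" if "x \<in> S" for x
  proof
    show "F differentiable (at x) \<Longrightarrow> G differentiable (at x)"
      using has_derivative_transform_within_open[OF _ assms(1) that, of F _ UNIV G] Suc.prems
      unfolding differentiable_def by metis
    show "G differentiable (at x) \<Longrightarrow> F differentiable (at x)"
      using has_derivative_transform_within_open[OF _ assms(1) that, of G _ UNIV F] Suc.prems
      unfolding differentiable_def by metis
  qed
  show ?case
  proof (cases "\<forall>x\<in>S. F differentiable (at x)")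
    case True
    have "frechet_derivative F (at x) = frechet_derivative G (at x)" if "x \<in> S" for x
      using frechet_derivative_transform_within_open[OF _ assms(1) that, of F G] Suc.prems True that by metis
    then have "Ck_on k (\<lambda>x. frechet_derivative F (at x) v) S \<longleftrightarrow>
        Ck_on k (\<lambda>x. frechet_derivative G (at x) v) S" for v
      by (intro Suc.IH) simp
    then show ?thesis using True * by simp
  next
    case False
    then show ?thesis using * by auto
  qed
qed

lemma Ck_on_bounded_linear:
  assumes "bounded_linear L" "open S"
  shows "Ck_on k F S \<Longrightarrow> Ck_on k (\<lambda>x. L (F x)) S"
proof (induction k arbitrary: F)
  case 0
  then show ?case using assms(1) by (auto intro: bounded_linear.continuous_on)
next
  case (Suc k)
  have d: "((\<lambda>x. L (F x)) has_derivative (\<lambda>v. L (frechet_derivative F (at x) v))) (at x)" if "x \<in> S" for x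
    using Suc.prems that bounded_linear.has_derivative[OF assms(1)] by (auto simp: frechet_derivative_works)
  then have "frechet_derivative (\<lambda>x. L (F x)) (at x) v = L (frechet_derivative F (at x) v)" if "x \<in> S" for x v
    using frechet_derivative_at[OF d[OF that]] by metis
  \<comment> \<open>The formula for the derivative holds only at points of \<open>S\<close>; since
    \<open>S\<close> is open, \<open>Ck_on_cong\<close> may substitute it before the induction
    hypothesis is used.\<close>
  then have "Ck_on k (\<lambda>x. frechet_derivative (\<lambda>x. L (F x)) (at x) v) S" for v
    using Suc by (subst Ck_on_cong[OF assms(2)]) auto
  then show ?case using d by (auto simp: differentiable_def)
qed

lemma Ck_on_add:
  assumes "open S"
  shows "Ck_on k F S \<Longrightarrow> Ck_on k G S \<Longrightarrow> Ck_on k (\<lambda>x. F x + G x) S"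
proof (induction k arbitrary: F G)
  case 0
  then show ?case by (auto intro: continuous_on_add)
next
  case (Suc k)
  have d: "((\<lambda>x. F x + G x) has_derivative
      (\<lambda>v. frechet_derivative F (at x) v + frechet_derivative G (at x) v)) (at x)" if "x \<in> S" for x
    using Suc.prems that by (intro has_derivative_add) (auto simp: frechet_derivative_works)
  then have "frechet_derivative (\<lambda>x. F x + G x) (at x) v
      = frechet_derivative F (at x) v + frechet_derivative G (at x) v" if "x \<in> S" for x v
    using frechet_derivative_at[OF d[OF that]] by metis
  then have "Ck_on k (\<lambda>x. frechet_derivative (\<lambda>x. F x + G x) (at x) v) S" for v
    using Suc by (subst Ck_on_cong[OF assms]) auto
  then show ?case using d by (auto simp: differentiable_def)
qed

lemma smooth_on_cong: "open S \<Longrightarrow> (\<And>x. x \<in> S \<Longrightarrow> F x = G x) \<Longrightarrow> smooth_on F S \<longleftrightarrow> smooth_on G S"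
  unfolding smooth_on_def using Ck_on_cong by blast

lemma smooth_on_bounded_linear:
  "bounded_linear L \<Longrightarrow> open S \<Longrightarrow> smooth_on F S \<Longrightarrow> smooth_on (\<lambda>x. L (F x)) S"
  unfolding smooth_on_def using Ck_on_bounded_linear by blast

lemma smooth_on_add:
  "open S \<Longrightarrow> smooth_on F S \<Longrightarrow> smooth_on G S \<Longrightarrow> smooth_on (\<lambda>x. F x + G x) S"
  unfolding smooth_on_def using Ck_on_add by blast

lemma smooth_on_frechet_derivative:
  "smooth_on F S \<Longrightarrow> smooth_on (\<lambda>x. frechet_derivative F (at x) v) S"
  unfolding smooth_on_def using Ck_on.simps(2) by blast

lemma smooth_on_continuous_on: "smooth_on F S \<Longrightarrow> continuous_on S F"
  unfolding smooth_on_def using Ck_on.simps(1) by blast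

section \<open>The mixed second difference and the symmetry of second derivatives\<close>

lemma has_derivative_along_line:
  assumes "(F has_derivative F') (at (a + t *\<^sub>R v))"
  shows "((\<lambda>t. F (a + t *\<^sub>R v)) has_derivative (\<lambda>h. h *\<^sub>R F' v)) (at t)"
proof -
  have "((\<lambda>t. a + t *\<^sub>R v) has_derivative (\<lambda>h. h *\<^sub>R v)) (at t)"
    by (auto intro!: derivative_eq_intros)
  from diff_chain_at[OF this, of F F'] assms
  have "(F \<circ> (\<lambda>t. a + t *\<^sub>R v) has_derivative F' \<circ> (\<lambda>h. h *\<^sub>R v)) (at t)" by simp
  moreover have "F' (h *\<^sub>R v) = h *\<^sub>R F' v" for h
    using assms by (simp add: has_derivative_linear linear_scale)
  ultimately show ?thesis by (simp add: o_def)
qed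

text \<open>The mean value theorem is used twice: in direction \<open>v\<close> for the difference
  of \<open>F\<close> along two parallel segments, then in direction \<open>w\<close> for the
  resulting derivative. The left-hand side is symmetric in \<open>v\<close> and \<open>w\<close>,
  the right-hand side is not; this is what the symmetry proof exploits.\<close>

lemma mixed_difference_mvt:
  fixes F :: "'a::real_normed_vector \<Rightarrow> real"
  assumes F: "\<And>y. y \<in> S \<Longrightarrow> F differentiable (at y)"
    and Fv: "\<And>y. y \<in> S \<Longrightarrow> (\<lambda>y. frechet_derivative F (at y) v) differentiable (at y)"
    and S: "\<And>s t. 0 \<le> s \<Longrightarrow> s \<le> r \<Longrightarrow> 0 \<le> t \<Longrightarrow> t \<le> r \<Longrightarrow> x + s *\<^sub>R v + t *\<^sub>R w \<in> S"
    and r: "r > 0"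
  obtains \<xi> \<eta> where "0 < \<xi>" "\<xi> < r" "0 < \<eta>" "\<eta> < r"
    "F (x + r *\<^sub>R v + r *\<^sub>R w) - F (x + r *\<^sub>R v) - F (x + r *\<^sub>R w) + F x
      = r\<^sup>2 * frechet_derivative (\<lambda>y. frechet_derivative F (at y) v)
          (at (x + \<xi> *\<^sub>R v + \<eta> *\<^sub>R w)) w"
proof -
  define Dv where "Dv y = frechet_derivative F (at y) v" for y
  have F': "((\<lambda>s. F (a + s *\<^sub>R v)) has_real_derivative Dv (a + s *\<^sub>R v)) (at s)"
    if "a + s *\<^sub>R v \<in> S" for a s
    using has_derivative_along_line[of F "frechet_derivative F (at (a + s *\<^sub>R v))" a s v] F[OF that]
    by (simp add: frechet_derivative_works has_field_derivative_def Dv_def mult_commute_abs)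
  have in1: "(x + r *\<^sub>R w) + s *\<^sub>R v \<in> S" and in2: "x + s *\<^sub>R v \<in> S" if "0 \<le> s" "s \<le> r" for s
    using S[of s r] S[of s 0] that r by (simp_all add: algebra_simps)
  \<comment> \<open>The function to which the mean value theorem applies is
    \<open>F (x + r w + s v) - F (x + s v)\<close> in the variable \<open>s\<close>.\<close>
  have "\<exists>z>0. z < r \<and>
      (F ((x + r *\<^sub>R w) + r *\<^sub>R v) - F (x + r *\<^sub>R v)) - (F ((x + r *\<^sub>R w) + 0 *\<^sub>R v) - F (x + 0 *\<^sub>R v))
      = (r - 0) * (Dv ((x + r *\<^sub>R w) + z *\<^sub>R v) - Dv (x + z *\<^sub>R v))"
    by (rule MVT2[OF r]) (intro DERIV_diff F' in1 in2)
  then obtain \<xi> where \<xi>: "0 < \<xi>" "\<xi> < r"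
    "F ((x + r *\<^sub>R w) + r *\<^sub>R v) - F (x + r *\<^sub>R v) - F (x + r *\<^sub>R w) + F x
      = r * (Dv ((x + r *\<^sub>R w) + \<xi> *\<^sub>R v) - Dv (x + \<xi> *\<^sub>R v))" by auto
  have Fv': "Dv differentiable (at y)" if "y \<in> S" for y
    using Fv[OF that] by (simp add: Dv_def[abs_def])
  have Dv': "((\<lambda>t. Dv (a + t *\<^sub>R w)) has_real_derivative frechet_derivative Dv (at (a + t *\<^sub>R w)) w) (at t)"
    if "a + t *\<^sub>R w \<in> S" for a t
    using has_derivative_along_line[of Dv "frechet_derivative Dv (at (a + t *\<^sub>R w))" a t w] Fv'[OF that]
    by (simp add: frechet_derivative_works has_field_derivative_def mult_commute_abs)
  have "\<exists>z>0. z < r \<and>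
      Dv ((x + \<xi> *\<^sub>R v) + r *\<^sub>R w) - Dv ((x + \<xi> *\<^sub>R v) + 0 *\<^sub>R w)
      = (r - 0) * frechet_derivative Dv (at ((x + \<xi> *\<^sub>R v) + z *\<^sub>R w)) w"
    by (rule MVT2[OF r]) (intro Dv' S, use \<xi> in auto)
  then obtain \<eta> where \<eta>: "0 < \<eta>" "\<eta> < r"
    "Dv ((x + \<xi> *\<^sub>R v) + r *\<^sub>R w) - Dv (x + \<xi> *\<^sub>R v)
      = r * frechet_derivative Dv (at (x + \<xi> *\<^sub>R v + \<eta> *\<^sub>R w)) w" by auto
  show ?thesis
  proof (rule that[OF \<xi>(1,2) \<eta>(1,2)])
    have e: "(x + r *\<^sub>R w) + \<xi> *\<^sub>R v = (x + \<xi> *\<^sub>R v) + r *\<^sub>R w"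
      "(x + r *\<^sub>R w) + r *\<^sub>R v = x + r *\<^sub>R v + r *\<^sub>R w" by (simp_all add: algebra_simps)
    show "F (x + r *\<^sub>R v + r *\<^sub>R w) - F (x + r *\<^sub>R v) - F (x + r *\<^sub>R w) + F x
      = r\<^sup>2 * frechet_derivative (\<lambda>y. frechet_derivative F (at y) v)
          (at (x + \<xi> *\<^sub>R v + \<eta> *\<^sub>R w)) w"
      using \<xi>(3) unfolding e \<eta>(3) by (simp add: Dv_def[abs_def] power2_eq_square)
  qed
qed

text \<open>Both mixed derivatives, taken at suitable points near \<open>x\<close>, equal the same
  second difference divided by the square of \<open>r\<close>; continuity of both at
  \<open>x\<close> lets the points tend to \<open>x\<close>.\<close>

lemma frechet_derivative_commute_real:
  fixes F :: "'a::real_normed_vector \<Rightarrow> real"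
  assumes S: "open S" "x \<in> S" and F: "smooth_on F S"
  shows "frechet_derivative (\<lambda>y. frechet_derivative F (at y) v) (at x) w
       = frechet_derivative (\<lambda>y. frechet_derivative F (at y) w) (at x) v"
proof -
  define P where "P y = frechet_derivative (\<lambda>y. frechet_derivative F (at y) v) (at y) w" for y
  define Q where "Q y = frechet_derivative (\<lambda>y. frechet_derivative F (at y) w) (at y) v" for y
  have "continuous_on S P" "continuous_on S Q"
    unfolding P_def Q_def by (intro smooth_on_continuous_on smooth_on_frechet_derivative F)+
  then have cont: "isCont P x" "isCont Q x"
    using S by (auto simp: continuous_on_eq_continuous_at)
  have "dist (P x) (Q x) < e" if e: "e > 0" for e
  proof -
    from cont(1) obtain d1 where d1: "d1 > 0" "\<And>y. dist y x < d1 \<Longrightarrow> dist (P y) (P x) < e / 2"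
      using e unfolding continuous_at_eps_delta by (metis half_gt_zero)
    from cont(2) obtain d2 where d2: "d2 > 0" "\<And>y. dist y x < d2 \<Longrightarrow> dist (Q y) (Q x) < e / 2"
      using e unfolding continuous_at_eps_delta by (metis half_gt_zero)
    from S obtain d3 where d3: "d3 > 0" "\<And>y. dist y x < d3 \<Longrightarrow> y \<in> S"
      unfolding open_dist by blast
    define d where "d = min d1 (min d2 d3)"
    \<comment> \<open>The summand 1 keeps \<open>n\<close> positive when \<open>v = w = 0\<close>.
      With \<open>r = d / (2 * n)\<close> the whole parallelogram spanned by \<open>r v\<close> and
      \<open>r w\<close> at \<open>x\<close> stays within \<open>d / 2\<close> of
      \<open>x\<close>.\<close>
    define n where "n = norm v + norm w + 1"
    define r where "r = d / (2 * n)"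
    have den: "n > 0" by (simp add: n_def add_nonneg_pos)
    have d: "d > 0" using d1 d2 d3 by (simp add: d_def)
    then have r: "r > 0" using den by (simp add: r_def)
    have close: "dist (x + s *\<^sub>R v + t *\<^sub>R w) x < d" if "0 \<le> s" "s \<le> r" "0 \<le> t" "t \<le> r" for s t
    proof -
      have "dist (x + s *\<^sub>R v + t *\<^sub>R w) x \<le> s * norm v + t * norm w"
        using norm_triangle_ineq[of "s *\<^sub>R v" "t *\<^sub>R w"] that by (simp add: dist_norm add.assoc)
      also have "\<dots> \<le> r * norm v + r * norm w" using that by (intro add_mono mult_right_mono) auto
      also have "\<dots> \<le> r * n" using r by (simp add: n_def algebra_simps)
      also have "\<dots> = d / 2" using den by (simp add: r_def)
      finally show ?thesis using d by simp
    qed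
    then have close': "dist (x + t *\<^sub>R w + s *\<^sub>R v) x < d" if "0 \<le> s" "s \<le> r" "0 \<le> t" "t \<le> r" for s t
      using that by (metis add.assoc add.commute)
    have diff: "F differentiable (at y)" "(\<lambda>y. frechet_derivative F (at y) u) differentiable (at y)"
      if "y \<in> S" for y u
      using that F smooth_on_differentiable smooth_on_frechet_derivative by blast+
    obtain a b where ab: "0 < a" "a < r" "0 < b" "b < r"
      "F (x + r *\<^sub>R v + r *\<^sub>R w) - F (x + r *\<^sub>R v) - F (x + r *\<^sub>R w) + F x
        = r\<^sup>2 * P (x + a *\<^sub>R v + b *\<^sub>R w)"
      using mixed_difference_mvt[of S F v r x w, OF diff(1) diff(2) _ r] close d3(2)
      unfolding P_def d_def by (metis min_less_iff_conj)
    obtain a' b' where ab': "0 < a'" "a' < r" "0 < b'" "b' < r"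
      "F (x + r *\<^sub>R w + r *\<^sub>R v) - F (x + r *\<^sub>R w) - F (x + r *\<^sub>R v) + F x
        = r\<^sup>2 * Q (x + b' *\<^sub>R w + a' *\<^sub>R v)"
      using mixed_difference_mvt[of S F w r x v, OF diff(1) diff(2) _ r] close' d3(2)
      unfolding Q_def d_def by (metis min_less_iff_conj)
    have e: "x + r *\<^sub>R w + r *\<^sub>R v = x + r *\<^sub>R v + r *\<^sub>R w" by (simp add: algebra_simps)
    have "r\<^sup>2 * P (x + a *\<^sub>R v + b *\<^sub>R w) = r\<^sup>2 * Q (x + b' *\<^sub>R w + a' *\<^sub>R v)"
      using ab(5) ab'(5) unfolding e by linarith
    then have eq: "P (x + a *\<^sub>R v + b *\<^sub>R w) = Q (x + b' *\<^sub>R w + a' *\<^sub>R v)" using r by simp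
    have "dist (P (x + a *\<^sub>R v + b *\<^sub>R w)) (P x) < e / 2"
      using close[of a b] ab by (intro d1) (simp add: d_def)
    moreover have "dist (Q (x + b' *\<^sub>R w + a' *\<^sub>R v)) (Q x) < e / 2"
      using close'[of a' b'] ab' by (intro d2) (simp add: d_def)
    ultimately show ?thesis using eq by (metis dist_commute dist_triangle_half_l)
  qed
  then have "P x = Q x" by (metis dist_pos_lt less_irrefl)
  then show ?thesis by (simp add: P_def Q_def)
qed

text \<open>The mean value theorem needs real values, so the real case is applied to the components
  \<open>F y \<bullet> b\<close>; the work is to pull the inner product out of both
  derivatives.\<close>

lemma frechet_derivative_commute:
  fixes F :: "'a::real_normed_vector \<Rightarrow> 'b::euclidean_space"
  assumes S: "open S" "x \<in> S" and F: "smooth_on F S"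
  shows "frechet_derivative (\<lambda>y. frechet_derivative F (at y) v) (at x) w
       = frechet_derivative (\<lambda>y. frechet_derivative F (at y) w) (at x) v"
proof (rule euclidean_eqI)
  fix b :: 'b assume "b \<in> Basis"
  have comp: "frechet_derivative (\<lambda>y. G y \<bullet> b) (at y) u = frechet_derivative G (at y) u \<bullet> b"
    if "smooth_on G S" "y \<in> S" for G :: "'a \<Rightarrow> 'b" and y u
  proof -
    have "((\<lambda>y. G y \<bullet> b) has_derivative (\<lambda>u. frechet_derivative G (at y) u \<bullet> b)) (at y)"
      using smooth_on_differentiable[OF that] by (auto simp: frechet_derivative_works intro!: has_derivative_inner_left)
    then show ?thesis using frechet_derivative_at by metis
  qed
  have comp2: "frechet_derivative (\<lambda>y. frechet_derivative (\<lambda>y. F y \<bullet> b) (at y) u) (at x) u'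
      = frechet_derivative (\<lambda>y. frechet_derivative F (at y) u) (at x) u' \<bullet> b" for u u'
  proof -
    have sm: "smooth_on (\<lambda>y. frechet_derivative F (at y) u) S"
      by (rule smooth_on_frechet_derivative[OF F])
    have "smooth_on (\<lambda>y. F y \<bullet> b) S"
      by (rule smooth_on_bounded_linear[OF bounded_linear_inner_left S(1) F])
    then have "smooth_on (\<lambda>y. frechet_derivative (\<lambda>y. F y \<bullet> b) (at y) u) S"
      by (rule smooth_on_frechet_derivative)
    then have "frechet_derivative (\<lambda>y. frechet_derivative (\<lambda>y. F y \<bullet> b) (at y) u) (at x)
      = frechet_derivative (\<lambda>y. frechet_derivative F (at y) u \<bullet> b) (at x)"
      using S(2) by (intro frechet_derivative_transform_within_open[OF _ S])
        (auto simp: comp[OF F] intro: smooth_on_differentiable)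
    then show ?thesis using comp[OF sm S(2)] by simp
  qed
  have "smooth_on (\<lambda>y. F y \<bullet> b) S"
    by (rule smooth_on_bounded_linear[OF bounded_linear_inner_left S(1) F])
  from frechet_derivative_commute_real[OF S this, of v w]
  show "frechet_derivative (\<lambda>y. frechet_derivative F (at y) v) (at x) w \<bullet> b
       = frechet_derivative (\<lambda>y. frechet_derivative F (at y) w) (at x) v \<bullet> b"
    by (simp add: comp2)
qed

section \<open>Inverse matrices\<close>

lemma differentiable_prod:
  fixes f :: "'i \<Rightarrow> 'a::real_normed_vector \<Rightarrow> 'b::real_normed_field"
  assumes "\<And>i. i \<in> I \<Longrightarrow> (f i) differentiable (at x)"
  shows "(\<lambda>y. \<Prod>i\<in>I. f i y) differentiable (at x)"
  using assms by (induction I rule: infinite_finite_induct) auto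

lemma differentiable_det:
  fixes X :: "'a::real_normed_vector \<Rightarrow> 'b::real_normed_field^'m^'m"
  assumes "\<And>i j. (\<lambda>y. X y $ i $ j) differentiable (at x)"
  shows "(\<lambda>y. det (X y)) differentiable (at x)"
proof -
  have "(\<lambda>y. \<Prod>i\<in>UNIV. X y $ i $ p i) differentiable (at x)" for p
    by (rule differentiable_prod) (rule assms)
  then show ?thesis unfolding det_def by (intro differentiable_sum differentiable_mult) auto
qed

text \<open>Cramer's rule writes each entry of the inverse as a quotient of two determinants, which
  are polynomials in the entries of \<open>X\<close>.\<close>

lemma differentiable_matrix_inv:
  fixes X :: "'a::real_normed_vector \<Rightarrow> 'b::real_normed_field^'m^'m"
  assumes S: "open S" "x \<in> S" and X: "\<And>i j. (\<lambda>y. X y $ i $ j) differentiable (at x)"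
    and inv: "\<And>y. y \<in> S \<Longrightarrow> invertible (X y)"
  shows "(\<lambda>y. matrix_inv (X y) $ i $ j) differentiable (at x)"
proof -
  \<comment> \<open>Column \<open>j\<close> of the inverse solves the linear system with right-hand
    side \<open>axis j 1\<close>; its entry \<open>i\<close> is obtained by putting that vector into
    column \<open>i\<close> of \<open>X\<close>.\<close>
  define N where "N y = (\<chi> a b. if b = i then axis j 1 $ a else X y $ a $ b)" for y
  have cr: "matrix_inv (X y) $ i $ j = det (N y) / det (X y)" if "y \<in> S" for y
  proof -
    have nz: "det (X y) \<noteq> 0" using inv[OF that] by (simp add: invertible_det_nz)
    have "X y *v column j (matrix_inv (X y)) = axis j 1"
      using matrix_inv_works(1)[OF inv[OF that]]
      by (simp add: vec_eq_iff matrix_vector_mult_def matrix_matrix_mult_def mat_def column_def axis_def)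
    then have "column j (matrix_inv (X y)) =
      (\<chi> k. det (\<chi> a b. if b = k then axis j 1 $ a else X y $ a $ b) / det (X y))"
      by (subst (asm) cramer[OF nz])
    then show ?thesis by (simp add: column_def N_def vec_eq_iff)
  qed
  have "(\<lambda>y. N y $ a $ b) differentiable (at x)" for a b
    using X by (cases "b = i") (simp_all add: N_def)
  then have dN: "(\<lambda>y. det (N y)) differentiable (at x)" by (rule differentiable_det)
  have "(\<lambda>y. det (N y) / det (X y)) differentiable (at x)"
    using inv[OF S(2)] by (intro differentiable_divide dN differentiable_det[of X] X) (auto simp: invertible_det_nz)
  then obtain D where "((\<lambda>y. det (N y) / det (X y)) has_derivative D) (at x)"
    by (auto simp: differentiable_def)
  then have "((\<lambda>y. matrix_inv (X y) $ i $ j) has_derivative D) (at x)"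
    by (rule has_derivative_transform_within_open[OF _ S]) (simp add: cr)
  then show ?thesis by (auto simp: differentiable_def)
qed

lemma upper_unique:
  fixes H :: "'k::field^'m^'m"
  assumes inv: "invertible H" and L: "\<And>\<alpha> \<gamma>. (\<Sum>\<beta>\<in>UNIV. L \<alpha> \<beta> * H $ \<gamma> $ \<beta>) = (if \<gamma> = \<alpha> then 1 else 0)"
  shows "upper H \<alpha> \<beta> = L \<alpha> \<beta>"
proof -
  have "upper H \<alpha> \<beta> = (\<Sum>\<gamma>\<in>UNIV. (\<Sum>\<delta>\<in>UNIV. L \<alpha> \<delta> * H $ \<gamma> $ \<delta>) * upper H \<gamma> \<beta>)"
    by (simp add: L if_distrib[of "\<lambda>x. x * _"] cong: if_cong)
  also have "\<dots> = (\<Sum>\<delta>\<in>UNIV. L \<alpha> \<delta> * (\<Sum>\<gamma>\<in>UNIV. upper H \<gamma> \<beta> * H $ \<gamma> $ \<delta>))"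
    unfolding sum_distrib_left sum_distrib_right by (subst sum.swap) (simp add: mult_ac)
  also have "\<dots> = L \<alpha> \<beta>"
    by (simp add: upper_inverse(2)[OF inv] if_distrib cong: if_cong)
  finally show ?thesis .
qed

text \<open>Conjugating the normalisation of \<open>upper H\<close> and using Hermitian symmetry
  gives the same normalisation for the conjugate transpose, so uniqueness of the inverse identifies
  the two.\<close>

lemma cnj_upper:
  fixes H :: "complex^'m^'m"
  assumes inv: "invertible H" and herm: "\<And>\<alpha> \<beta>. H $ \<beta> $ \<alpha> = cnj (H $ \<alpha> $ \<beta>)"
  shows "cnj (upper H \<alpha> \<beta>) = upper H \<beta> \<alpha>"
proof -
  have "(\<Sum>\<beta>\<in>UNIV. cnj (upper H \<beta> \<alpha>) * H $ \<gamma> $ \<beta>) = (if \<gamma> = \<alpha> then 1 else 0)" for \<alpha> \<gamma>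
  proof -
    have "(\<Sum>\<beta>\<in>UNIV. cnj (upper H \<beta> \<alpha>) * H $ \<gamma> $ \<beta>) = cnj (\<Sum>\<beta>\<in>UNIV. upper H \<beta> \<alpha> * H $ \<beta> $ \<gamma>)"
      unfolding cnj_sum complex_cnj_mult herm[symmetric] ..
    then show ?thesis by (simp add: upper_inverse(2)[OF inv])
  qed
  from upper_unique[where L = "\<lambda>\<alpha> \<beta>. cnj (upper H \<beta> \<alpha>)", OF inv this] show ?thesis ..
qed

section \<open>Calculus in charts\<close>

text \<open>Differentiability at a single point: all that the sum and product rules ask for.
  Smoothness on a region is kept as a separate notion, for those functions that are differentiated
  repeatedly.\<close>

definition chart_diff :: "('a, 'e::real_normed_vector) chart \<Rightarrow> ('a \<Rightarrow> 'k::real_normed_vector) \<Rightarrow> 'a \<Rightarrow> bool" where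
  "chart_diff c F p \<longleftrightarrow> (F \<circ> cinv c) differentiable (at (cmap c p))"

lemma chart_diff_has_derivative:
  "chart_diff c F p \<longleftrightarrow> ((\<lambda>y. F (cinv c y)) has_derivative (\<lambda>v. dirD c F v p)) (at (cmap c p))"
  by (simp add: chart_diff_def dirD_def frechet_derivative_works o_def eta_contract_eq)

lemma has_derivative_dirD:
  assumes "((\<lambda>y. F (cinv c y)) has_derivative D) (at (cmap c p))"
  shows "chart_diff c F p" "dirD c F v p = D v"
  using assms frechet_derivative_at[OF assms]
  by (auto simp: chart_diff_def dirD_def differentiable_def o_def)

lemma chart_diff_const [simp]: "chart_diff c (\<lambda>_. k) p"
  and dirD_const [simp]: "dirD c (\<lambda>_. k) v p = 0"
  using has_derivative_dirD[of "\<lambda>_. k" c "\<lambda>_. 0" p] by auto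

lemma
  assumes "chart_diff c F p" "chart_diff c G p"
  shows chart_diff_add: "chart_diff c (\<lambda>q. F q + G q) p"
    and dirD_add: "dirD c (\<lambda>q. F q + G q) v p = dirD c F v p + dirD c G v p"
  using has_derivative_dirD[of "\<lambda>q. F q + G q" c, OF has_derivative_add] assms
  by (auto simp: chart_diff_has_derivative)

lemma
  fixes F G :: "'a \<Rightarrow> 'k::real_normed_algebra"
  assumes "chart_diff c F p" "chart_diff c G p" "cinv c (cmap c p) = p"
  shows chart_diff_mult: "chart_diff c (\<lambda>q. F q * G q) p"
    and dirD_mult: "dirD c (\<lambda>q. F q * G q) v p = dirD c F v p * G p + F p * dirD c G v p"
  using has_derivative_dirD[of "\<lambda>q. F q * G q" c,
      OF has_derivative_mult[OF assms(1,2)[unfolded chart_diff_has_derivative]]] assms(3)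
  by auto

lemma
  assumes "\<And>i. i \<in> I \<Longrightarrow> chart_diff c (F i) p"
  shows chart_diff_sum: "chart_diff c (\<lambda>q. \<Sum>i\<in>I. F i q) p"
    and dirD_sum: "dirD c (\<lambda>q. \<Sum>i\<in>I. F i q) v p = (\<Sum>i\<in>I. dirD c (F i) v p)"
  using has_derivative_dirD[of "\<lambda>q. \<Sum>i\<in>I. F i q" c,
      OF has_derivative_sum[OF assms[unfolded chart_diff_has_derivative]]]
  by auto

lemma
  assumes "chart_diff c F p" "bounded_linear L"
  shows chart_diff_linear: "chart_diff c (\<lambda>q. L (F q)) p"
    and dirD_linear: "dirD c (\<lambda>q. L (F q)) v p = L (dirD c F v p)"
  using has_derivative_dirD[of "\<lambda>q. L (F q)" c, OF bounded_linear.has_derivative[OF assms(2)]] assms(1)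
  by (auto simp: chart_diff_has_derivative)

lemma linear_dirD: "chart_diff c F p \<Longrightarrow> linear (\<lambda>v. dirD c F v p)"
  unfolding chart_diff_has_derivative by (rule has_derivative_linear)

text \<open>The region \<open>W\<close> may be smaller than the chart domain, because later it must
  also be mapped by \<open>f\<close> into one chart of the target. Openness of its image makes
  derivatives in \<open>c\<close> at points of \<open>W\<close> depend only on values on
  \<open>W\<close>.\<close>

locale chart_region =
  fixes c :: "('a, 'e::euclidean_space) chart" and W :: "'a set"
  assumes open_image: "open (cmap c ` W)"
    and cinv_cmap: "\<And>x. x \<in> W \<Longrightarrow> cinv c (cmap c x) = x"
begin

lemma dirD_cong:
  assumes "\<And>q. q \<in> W \<Longrightarrow> F q = G q" "p \<in> W"
  shows "dirD c F v p = dirD c G v p"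
proof -
  have "((F \<circ> cinv c) has_derivative D) (at (cmap c p)) \<longleftrightarrow>
      ((G \<circ> cinv c) has_derivative D) (at (cmap c p))" for D
  proof
    show "((F \<circ> cinv c) has_derivative D) (at (cmap c p)) \<Longrightarrow>
      ((G \<circ> cinv c) has_derivative D) (at (cmap c p))"
      by (erule has_derivative_transform_within_open[OF _ open_image])
        (use assms in \<open>auto simp: cinv_cmap\<close>)
    show "((G \<circ> cinv c) has_derivative D) (at (cmap c p)) \<Longrightarrow>
      ((F \<circ> cinv c) has_derivative D) (at (cmap c p))"
      by (erule has_derivative_transform_within_open[OF _ open_image])
        (use assms in \<open>auto simp: cinv_cmap\<close>)
  qed
  then show ?thesis by (simp add: dirD_def frechet_derivative_def)
qed

definition region_smooth :: "('a \<Rightarrow> 'k::real_normed_vector) \<Rightarrow> bool" where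
  "region_smooth F \<longleftrightarrow> smooth_on (F \<circ> cinv c) (cmap c ` W)"

lemma region_smooth_diff: "region_smooth F \<Longrightarrow> p \<in> W \<Longrightarrow> chart_diff c F p"
  unfolding region_smooth_def chart_diff_def by (erule smooth_on_differentiable) auto

lemma region_smooth_dirD: "region_smooth F \<Longrightarrow> region_smooth (dirD c F v)"
  unfolding region_smooth_def
  by (drule smooth_on_frechet_derivative[where v=v], erule iffD1[OF smooth_on_cong, rotated 2])
    (auto simp: open_image dirD_def cinv_cmap)

lemma region_smooth_add: "region_smooth F \<Longrightarrow> region_smooth G \<Longrightarrow> region_smooth (\<lambda>q. F q + G q)"
  using smooth_on_add[OF open_image] by (fastforce simp: region_smooth_def o_def)

lemma region_smooth_linear: "bounded_linear L \<Longrightarrow> region_smooth F \<Longrightarrow> region_smooth (\<lambda>q. L (F q))"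
  using smooth_on_bounded_linear[OF _ open_image] by (fastforce simp: region_smooth_def o_def)

text \<open>Iterating \<open>dirD\<close> returns to the manifold in between and so inserts
  \<open>cinv c\<close> and \<open>cmap c\<close>; these cancel on the open image of
  \<open>W\<close>, which reduces the claim to Euclidean space.\<close>

lemma dirD_commute:
  fixes F :: "'a \<Rightarrow> 'k::euclidean_space"
  assumes "region_smooth F" "p \<in> W"
  shows "dirD c (dirD c F v) w p = dirD c (dirD c F w) v p"
proof -
  have "dirD c (dirD c F v) w p = frechet_derivative (\<lambda>y. frechet_derivative (F \<circ> cinv c) (at y) v) (at (cmap c p)) w"
    for v w
  proof -
    have sm: "smooth_on (F \<circ> cinv c) (cmap c ` W)" using assms(1) by (simp add: region_smooth_def)
    have "frechet_derivative (\<lambda>y. frechet_derivative (F \<circ> cinv c) (at y) v) (at (cmap c p))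
      = frechet_derivative (dirD c F v \<circ> cinv c) (at (cmap c p))"
      using assms(2)
      by (intro frechet_derivative_transform_within_open[OF _ open_image] smooth_on_differentiable[OF
        smooth_on_frechet_derivative[OF sm]]) (auto simp: dirD_def cinv_cmap)
    then show ?thesis by (simp add: dirD_def)
  qed
  then show ?thesis
    using frechet_derivative_commute[OF open_image, of "cmap c p" "F \<circ> cinv c"] assms
    by (simp add: region_smooth_def)
qed

end

text \<open>The Wirtinger derivatives in a uniform notation: \<open>e = 1\<close> gives \<open>\<partial>/\<partial>z\<^sup>\<alpha>\<close> and \<open>e = -1\<close> its
  conjugate.\<close>

definition wirt :: "complex \<Rightarrow> ('a, complex^'m) chart \<Rightarrow> 'm \<Rightarrow> ('a \<Rightarrow> complex) \<Rightarrow> 'a \<Rightarrow> complex" where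
  "wirt e c \<alpha> F p = (dirD c F (axis \<alpha> 1) p - e * \<i> * dirD c F (axis \<alpha> \<i>) p) / 2"

lemma pdz_wirt: "pdz = wirt 1" and pdzbar_wirt: "pdzbar = wirt (-1)"
  by (simp_all add: fun_eq_iff pdz_def pdzbar_def wirt_def coeff10_def coeff01_def)

lemma wirt_add: "chart_diff c F p \<Longrightarrow> chart_diff c G p \<Longrightarrow>
    wirt e c \<alpha> (\<lambda>q. F q + G q) p = wirt e c \<alpha> F p + wirt e c \<alpha> G p"
  by (simp add: wirt_def dirD_add add_divide_distrib diff_divide_distrib algebra_simps)

lemma wirt_mult: "chart_diff c F p \<Longrightarrow> chart_diff c G p \<Longrightarrow> cinv c (cmap c p) = p \<Longrightarrow>
    wirt e c \<alpha> (\<lambda>q. F q * G q) p = wirt e c \<alpha> F p * G p + F p * wirt e c \<alpha> G p"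
  by (simp add: wirt_def dirD_mult add_divide_distrib diff_divide_distrib algebra_simps)

lemma wirt_sum: "(\<And>i. i \<in> I \<Longrightarrow> chart_diff c (F i) p) \<Longrightarrow>
    wirt e c \<alpha> (\<lambda>q. \<Sum>i\<in>I. F i q) p = (\<Sum>i\<in>I. wirt e c \<alpha> (F i) p)"
  by (simp add: wirt_def dirD_sum sum_subtractf sum_distrib_left flip: sum_divide_distrib)

text \<open>The multiplicativity assumption makes \<open>L\<close> multiplication by the constant
  \<open>L 1\<close>, so it commutes with the complex coefficients in \<open>wirt\<close>.
  Conjugation is only real-linear and is treated in \<open>wirt_cnj\<close>.\<close>

lemma wirt_linear:
  assumes "chart_diff c F p" "\<And>x y. L (x * y) = x * L y" "bounded_linear L"
  shows "wirt e c \<alpha> (\<lambda>q. L (F q)) p = L (wirt e c \<alpha> F p)"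
proof -
  have L: "L y = y * L 1" for y using assms(2)[of y 1] by simp
  show ?thesis unfolding wirt_def dirD_linear[OF assms(1,3)]
    by (subst (1 2 3) L) (simp add: algebra_simps add_divide_distrib diff_divide_distrib)
qed

lemma wirt_minus: "chart_diff c F p \<Longrightarrow> wirt e c \<alpha> (\<lambda>q. - F q) p = - wirt e c \<alpha> F p"
  by (rule wirt_linear) (auto intro: bounded_linear_minus bounded_linear_ident)

lemma chart_diff_minus: "chart_diff c F p \<Longrightarrow> chart_diff c (\<lambda>q. - F q) p"
  by (rule chart_diff_linear) (auto intro: bounded_linear_minus bounded_linear_ident)

lemma chart_diff_cnj: "chart_diff c F p \<Longrightarrow> chart_diff c (\<lambda>q. cnj (F q)) p"
  by (rule chart_diff_linear) (auto intro: bounded_linear_cnj)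

text \<open>For \<open>e = 1\<close> and \<open>e = -1\<close> the value \<open>- cnj e\<close> is
  the opposite sign: conjugation exchanges the two types of derivative.\<close>

lemma wirt_cnj:
  "chart_diff c F p \<Longrightarrow> wirt e c \<alpha> (\<lambda>q. cnj (F q)) p = cnj (wirt (- cnj e) c \<alpha> F p)"
  by (simp add: wirt_def dirD_linear[OF _ bounded_linear_cnj])

lemma wirt_const [simp]: "wirt e c \<alpha> (\<lambda>_. k) p = 0"
  by (simp add: wirt_def)

locale complex_region = chart_region c W for c :: "('a, complex^'m) chart" and W
begin

lemma region_smooth_wirt:
  assumes "region_smooth F"
  shows "region_smooth (wirt e c \<alpha> F)"
proof -
  have "region_smooth (\<lambda>q. (1/2) * dirD c F (axis \<alpha> 1) q + (- e * \<i> / 2) * dirD c F (axis \<alpha> \<i>) q)"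
    by (intro region_smooth_add region_smooth_linear[OF bounded_linear_mult_right]
        region_smooth_dirD assms)
  moreover have "wirt e c \<alpha> F =
      (\<lambda>q. (1/2) * dirD c F (axis \<alpha> 1) q + (- e * \<i> / 2) * dirD c F (axis \<alpha> \<i>) q)"
    by (simp add: fun_eq_iff wirt_def diff_divide_distrib)
  ultimately show ?thesis by simp
qed

lemma wirt_cong: "(\<And>q. q \<in> W \<Longrightarrow> F q = G q) \<Longrightarrow> p \<in> W \<Longrightarrow> wirt e c \<alpha> F p = wirt e c \<alpha> G p"
  using dirD_cong[of F G p] by (simp add: wirt_def)

text \<open>Wirtinger derivatives are combinations with constant coefficients of directional
  derivatives, which commute. Keeping both signs arbitrary covers the pure and the mixed second
  derivatives at once.\<close>

lemma wirt_commute: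
  assumes F: "region_smooth F" and p: "p \<in> W"
  shows "wirt e c \<alpha> (wirt e' c \<beta> F) p = wirt e' c \<beta> (wirt e c \<alpha> F) p"
proof -
  have *: "dirD c (wirt e c \<beta> F) v p
      = (1/2) * dirD c (dirD c F (axis \<beta> 1)) v p + (- e * \<i> / 2) * dirD c (dirD c F (axis \<beta> \<i>)) v p"
    for e \<beta> v
  proof -
    have d: "chart_diff c (dirD c F u) p" for u
      using region_smooth_diff[OF region_smooth_dirD[OF F] p] .
    have "wirt e c \<beta> F = (\<lambda>q. (1/2) * dirD c F (axis \<beta> 1) q + (- e * \<i> / 2) * dirD c F (axis \<beta> \<i>) q)"
      by (simp add: fun_eq_iff wirt_def diff_divide_distrib)
    then show ?thesis
      by (simp only: dirD_add[OF chart_diff_linear[OF d bounded_linear_mult_right]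
            chart_diff_linear[OF d bounded_linear_mult_right]] dirD_linear[OF d bounded_linear_mult_right])
  qed
  show ?thesis
    unfolding wirt_def[of e c \<alpha>] wirt_def[of e' c \<beta>] *
    using dirD_commute[OF F p, of "axis \<alpha> 1" "axis \<beta> 1"] dirD_commute[OF F p, of "axis \<alpha> \<i>" "axis \<beta> 1"]
      dirD_commute[OF F p, of "axis \<alpha> 1" "axis \<beta> \<i>"] dirD_commute[OF F p, of "axis \<alpha> \<i>" "axis \<beta> \<i>"]
    by (simp add: algebra_simps)
qed

end

text \<open>The chain rule for a real function on the target. The function and the coordinates of
  \<open>f\<close> are real, so the same real partial derivatives serve as coefficients for both
  types of Wirtinger derivative.\<close>

lemma
  fixes \<phi> :: "'b \<Rightarrow> real" and d :: "('b, real^'n) chart"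
  assumes c: "complex_region c W" "p \<in> W" and d: "chart_region d V" "\<And>q. q \<in> W \<Longrightarrow> f q \<in> V"
    and f: "(cmap d \<circ> f \<circ> cinv c) differentiable (at (cmap c p))" and \<phi>: "chart_diff d \<phi> (f p)"
  shows chart_diff_pullback: "chart_diff c (\<lambda>q. complex_of_real (\<phi> (f q))) p"
    and wirt_pullback: "wirt e c \<alpha> (\<lambda>q. complex_of_real (\<phi> (f q))) p
      = (\<Sum>k\<in>UNIV. of_real (pdy d k \<phi> (f p)) * wirt e c \<alpha> (coord_f d f k) p)"
proof -
  interpret c: complex_region c W by fact
  interpret d: chart_region d V by fact
  obtain P where P: "((\<lambda>y. cmap d (f (cinv c y))) has_derivative P) (at (cmap c p))"
    using f by (auto simp: differentiable_def o_def)
  have Pk: "dirD c (coord_f d f k) v p = of_real (P v $ k)" for k v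
    using bounded_linear.has_derivative[OF bounded_linear_of_real
        bounded_linear.has_derivative[OF bounded_linear_vec_nth P]]
    by (intro has_derivative_dirD(2)) (simp add: coord_f_def)
  have "((\<phi> \<circ> cinv d) has_derivative (\<lambda>v. dirD d \<phi> v (f p))) (at (cmap d (f (cinv c (cmap c p)))))"
    using \<phi> c(2) by (simp add: chart_diff_has_derivative c.cinv_cmap o_def)
  from diff_chain_at[OF P this]
  have "((\<lambda>y. \<phi> (cinv d (cmap d (f (cinv c y))))) has_derivative (\<lambda>v. dirD d \<phi> (P v) (f p))) (at (cmap c p))"
    by (simp add: o_def)
  then have "((\<lambda>y. \<phi> (f (cinv c y))) has_derivative (\<lambda>v. dirD d \<phi> (P v) (f p))) (at (cmap c p))"
    by (rule has_derivative_transform_within_open[OF _ c.open_image])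
      (use c(2) d(2) in \<open>auto simp: c.cinv_cmap d.cinv_cmap\<close>)
  from has_derivative_dirD[of "\<lambda>q. complex_of_real (\<phi> (f q))", OF
      bounded_linear.has_derivative[OF bounded_linear_of_real this]]
  have 1: "chart_diff c (\<lambda>q. complex_of_real (\<phi> (f q))) p"
    and 2: "\<And>v. dirD c (\<lambda>q. complex_of_real (\<phi> (f q))) v p = of_real (dirD d \<phi> (P v) (f p))"
    by auto
  have "dirD d \<phi> y (f p) = (\<Sum>k\<in>UNIV. pdy d k \<phi> (f p) * y $ k)" for y
  proof -
    have "y = (\<Sum>k\<in>UNIV. (y $ k) *\<^sub>R axis k 1)"
      by (simp add: vec_eq_iff axis_def if_distrib cong: if_cong)
    then have "dirD d \<phi> y (f p) = dirD d \<phi> (\<Sum>k\<in>UNIV. (y $ k) *\<^sub>R axis k 1) (f p)" by simp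
    also have "\<dots> = (\<Sum>k\<in>UNIV. pdy d k \<phi> (f p) * y $ k)"
      using linear_dirD[OF \<phi>] by (simp add: linear_sum[where f="\<lambda>v. dirD d \<phi> v (f p)"]
          linear_scale[where f="\<lambda>v. dirD d \<phi> v (f p)"] pdy_def mult.commute)
    finally show ?thesis .
  qed
  then have 3: "dirD c (\<lambda>q. complex_of_real (\<phi> (f q))) v p
      = (\<Sum>k\<in>UNIV. of_real (pdy d k \<phi> (f p)) * dirD c (coord_f d f k) v p)" for v
    by (simp add: 2 Pk)
  show "chart_diff c (\<lambda>q. complex_of_real (\<phi> (f q))) p" by (rule 1)
  show "wirt e c \<alpha> (\<lambda>q. complex_of_real (\<phi> (f q))) p
      = (\<Sum>k\<in>UNIV. of_real (pdy d k \<phi> (f p)) * wirt e c \<alpha> (coord_f d f k) p)"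
    unfolding wirt_def 3
    by (simp add: sum_divide_distrib sum_distrib_left sum_subtractf[symmetric] algebra_simps diff_divide_distrib)
qed

lemma (in chart_region) chart_diff_upper:
  fixes H :: "'a \<Rightarrow> 'k::real_normed_field^'m^'m"
  assumes "\<And>q. q \<in> W \<Longrightarrow> invertible (H q)" "\<And>i j. chart_diff c (\<lambda>q. H q $ i $ j) p" "p \<in> W"
  shows "chart_diff c (\<lambda>q. upper (H q) i j) p"
proof -
  have "(\<lambda>y. matrix_inv (H (cinv c y)) $ j $ i) differentiable (at (cmap c p))"
    using assms by (intro differentiable_matrix_inv[OF open_image])
      (auto simp: chart_diff_def o_def cinv_cmap)
  then show ?thesis by (simp add: chart_diff_def upper_def o_def)
qed

section \<open>The Levi-Civita connection in a chart\<close>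

lemma pdy_const [simp]: "pdy d k (\<lambda>_. r) q = 0"
  by (simp add: pdy_def)

lemma pdy_add: "chart_diff d F q \<Longrightarrow> chart_diff d G q \<Longrightarrow>
    pdy d k (\<lambda>x. F x + G x) q = pdy d k F q + pdy d k G q"
  by (simp add: pdy_def dirD_add)

lemma pdy_mult: "chart_diff d F q \<Longrightarrow> chart_diff d G q \<Longrightarrow> cinv d (cmap d q) = q \<Longrightarrow>
    pdy d k (\<lambda>x. F x * G x) q = pdy d k F q * G q + F q * pdy d k G q"
  by (simp add: pdy_def dirD_mult)

lemma pdy_sum: "(\<And>i. i \<in> I \<Longrightarrow> chart_diff d (F i) q) \<Longrightarrow>
    pdy d k (\<lambda>x. \<Sum>i\<in>I. F i x) q = (\<Sum>i\<in>I. pdy d k (F i) q)"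
  by (simp add: pdy_def dirD_sum)

section \<open>The curvature of the target in coordinates\<close>

definition curv :: "(('b, real^'n) chart \<Rightarrow> 'b \<Rightarrow> real^'n^'n) \<Rightarrow> ('b, real^'n) chart
    \<Rightarrow> 'n \<Rightarrow> 'n \<Rightarrow> 'n \<Rightarrow> 'n \<Rightarrow> 'b \<Rightarrow> real" where
  "curv g d i j k a q = pdy d i (christoffel g d a j k) q - pdy d j (christoffel g d a i k) q
     + (\<Sum>m\<in>UNIV. christoffel g d a i m q * christoffel g d m j k q)
     - (\<Sum>m\<in>UNIV. christoffel g d a j m q * christoffel g d m i k q)"

text \<open>\<open>curv g d i j k a\<close> is the component along \<open>e_a\<close> of R(e_i, e_j)
  e_k for coordinate fields. These fields have constant components and commute, so the bracket term
  of the curvature operator vanishes.\<close>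

lemma RN_curv:
  fixes g :: "('b, real^'n) chart \<Rightarrow> 'b \<Rightarrow> real^'n^'n"
  shows "RN g d i j k l q = (\<Sum>a\<in>UNIV. g d q $ a $ l * curv g d i j k a q)"
proof -
  have axis: "(axis i 1 :: real^'n) $ j = (if j = i then 1 else 0)" for i j :: 'n
    by (simp add: axis_def)
  note delta = axis if_distrib[where f="\<lambda>x. x * r" for r :: real]
    if_distrib[where f="\<lambda>x. r * x" for r :: real]
  have delta2: "(\<Sum>k\<in>UNIV. if b then F k else 0) = (if b then \<Sum>k\<in>UNIV. F k else 0)"
    for b and F :: "'n \<Rightarrow> real" by simp
  have 1: "levi_civita g d (\<lambda>_. axis i 1) (\<lambda>_. axis j 1) = (\<lambda>q. \<chi> a. christoffel g d a i j q)" for i j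
    by (simp add: fun_eq_iff levi_civita_def vec_eq_iff delta cong: if_cong)
  have 2: "lie_bracket d (\<lambda>_. axis i 1) (\<lambda>_. axis j 1) = (\<lambda>q. 0)" for i j :: 'n
    by (simp add: fun_eq_iff lie_bracket_def vec_eq_iff)
  have 3: "levi_civita g d (\<lambda>_. 0) Z q = 0" for Z
    by (simp add: levi_civita_def vec_eq_iff)
  have "riemann_op g d (\<lambda>_. axis i 1) (\<lambda>_. axis j 1) (\<lambda>_. axis k 1) q $ a = curv g d i j k a q" for a
    unfolding riemann_op_def 1 2 3
    by (simp add: levi_civita_def curv_def delta delta2 cong: if_cong)
  then show ?thesis
    by (simp add: RN_def delta cong: if_cong)
qed

locale riemannian_chart =
  fixes B :: "('b::{t2_space,second_countable_topology}, real^'n) chart set"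
    and g :: "('b, real^'n) chart \<Rightarrow> 'b \<Rightarrow> real^'n^'n" and d :: "('b, real^'n) chart"
  assumes N: "riemannian_manifold B g" and d: "d \<in> B"
begin

sublocale N: chart_region d "cdom d"
  using N atlas_chart[of smooth_on B d] d by unfold_locales (auto simp: riemannian_manifold_def)

lemma g_sym: "q \<in> cdom d \<Longrightarrow> g d q $ j $ i = g d q $ i $ j"
  using N d by (auto simp: riemannian_manifold_def riemannian_metric_def)

lemma g_invertible: "q \<in> cdom d \<Longrightarrow> invertible (g d q)"
  using N d by (intro invertible_riemannian) (auto simp: riemannian_manifold_def riemannian_metric_def)

lemma g_smooth: "N.region_smooth (\<lambda>q. g d q $ i $ j)"
proof -
  have "N.region_smooth (g d)"
    using N d by (simp add: riemannian_manifold_def riemannian_metric_def N.region_smooth_def)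
  then show ?thesis
    by (intro N.region_smooth_linear[OF bounded_linear_compose[OF bounded_linear_vec_nth bounded_linear_vec_nth]])
qed

lemma g_diff: "q \<in> cdom d \<Longrightarrow> chart_diff d (\<lambda>x. g d x $ i $ j) q"
  by (rule N.region_smooth_diff[OF g_smooth])

lemma dg_diff: "q \<in> cdom d \<Longrightarrow> chart_diff d (\<lambda>x. pdy d k (\<lambda>x. g d x $ i $ j) x) q"
  unfolding pdy_def by (rule N.region_smooth_diff[OF N.region_smooth_dirD[OF g_smooth]])

lemma christoffel_diff: "q \<in> cdom d \<Longrightarrow> chart_diff d (christoffel g d i j k) q"
proof -
  assume q: "q \<in> cdom d"
  have c: "cinv d (cmap d q) = q" by (rule N.cinv_cmap[OF q])
  have m: "chart_diff d (\<lambda>x. - F x) q" if "chart_diff d F q" for F :: "'b \<Rightarrow> real"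
    using that by (rule chart_diff_linear) (auto intro: bounded_linear_minus bounded_linear_ident)
  have "chart_diff d (\<lambda>q. (1/2) * (\<Sum>l\<in>UNIV. upper (g d q) i l *
     (pdy d j (\<lambda>x. g d x $ k $ l) q + pdy d k (\<lambda>x. g d x $ j $ l) q + - pdy d l (\<lambda>x. g d x $ j $ k) q))) q"
    by (intro chart_diff_mult chart_diff_const chart_diff_sum chart_diff_add m dg_diff q c
        N.chart_diff_upper g_invertible g_diff)
  then show ?thesis by (simp add: christoffel_def[abs_def])
qed

text \<open>Differentiating the metric property of the connection once more expresses the second
  derivatives of \<open>g\<close> through Christoffel symbols. Since second derivatives commute,
  antisymmetrising in \<open>i\<close> and \<open>j\<close> gives zero on one side and the sum of
  the two curvature components on the other.\<close>

lemma RN_antisym: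
  assumes q: "q \<in> cdom d"
  shows "RN g d i j l k q = - RN g d i j k l q"
proof -
  let ?G = "\<lambda>a j k. christoffel g d a j k q"
  let ?D = "\<lambda>i a j k. pdy d i (christoffel g d a j k) q"
  let ?g = "\<lambda>a b. g d q $ a $ b"
  note c = N.cinv_cmap[OF q]
  have T: "pdy d i (pdy d j (\<lambda>x. g d x $ k $ l)) q =
      (\<Sum>a\<in>UNIV. ?D i a j k * ?g a l) + (\<Sum>a\<in>UNIV. \<Sum>b\<in>UNIV. ?G a j k * ?G b i a * ?g b l)
      + (\<Sum>a\<in>UNIV. \<Sum>b\<in>UNIV. ?G a j k * ?G b i l * ?g b a)
      + ((\<Sum>a\<in>UNIV. ?D i a j l * ?g a k) + (\<Sum>a\<in>UNIV. \<Sum>b\<in>UNIV. ?G a j l * ?G b i a * ?g b k)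
      + (\<Sum>a\<in>UNIV. \<Sum>b\<in>UNIV. ?G a j l * ?G b i k * ?g b a))" for i j
  proof -
    have "pdy d i (pdy d j (\<lambda>x. g d x $ k $ l)) q =
      pdy d i (\<lambda>q. (\<Sum>a\<in>UNIV. christoffel g d a j k q * g d q $ a $ l)
        + (\<Sum>a\<in>UNIV. christoffel g d a j l q * g d q $ a $ k)) q"
      unfolding pdy_def[of d i] by (rule N.dirD_cong[OF _ q]) (rule levi_civita_metric[OF N d])
    also have "\<dots> = (\<Sum>a\<in>UNIV. ?D i a j k * ?g a l + ?G a j k * pdy d i (\<lambda>q. g d q $ a $ l) q)
        + (\<Sum>a\<in>UNIV. ?D i a j l * ?g a k + ?G a j l * pdy d i (\<lambda>q. g d q $ a $ k) q)"
      by (simp add: pdy_add pdy_sum pdy_mult chart_diff_sum chart_diff_mult christoffel_diff g_diff q c)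
    finally show ?thesis
      by (simp add: levi_civita_metric[OF N d q] sum.distrib sum_distrib_left algebra_simps)
  qed
  \<comment> \<open>The terms in which one Christoffel symbol acts on \<open>k\<close> and the other
    on \<open>l\<close>: exchanging \<open>i\<close> and \<open>j\<close> permutes them, so they
    cancel in the antisymmetrisation.\<close>
  have sw: "(\<Sum>a\<in>UNIV. \<Sum>b\<in>UNIV. ?G a j k * ?G b i l * ?g b a)
      = (\<Sum>a\<in>UNIV. \<Sum>b\<in>UNIV. ?G a i l * ?G b j k * ?g b a)" for i j k l
    by (subst sum.swap) (simp add: g_sym[OF q] mult_ac)
  have R: "RN g d i j k l q = (\<Sum>a\<in>UNIV. ?D i a j k * ?g a l) - (\<Sum>a\<in>UNIV. ?D j a i k * ?g a l)
      + (\<Sum>a\<in>UNIV. \<Sum>b\<in>UNIV. ?G a j k * ?G b i a * ?g b l)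
      - (\<Sum>a\<in>UNIV. \<Sum>b\<in>UNIV. ?G a i k * ?G b j a * ?g b l)" for k l
  proof -
    have "(\<Sum>a\<in>UNIV. \<Sum>b\<in>UNIV. ?G a j k * ?G b i a * ?g b l)
        = (\<Sum>b\<in>UNIV. ?g b l * (\<Sum>a\<in>UNIV. ?G b i a * ?G a j k))" for i j
      by (subst sum.swap) (simp add: sum_distrib_left mult_ac)
    then show ?thesis
      by (simp add: RN_curv curv_def algebra_simps sum.distrib sum_subtractf)
  qed
  have "pdy d i (pdy d j (\<lambda>x. g d x $ k $ l)) q = pdy d j (pdy d i (\<lambda>x. g d x $ k $ l)) q"
    unfolding pdy_def by (rule N.dirD_commute[OF g_smooth q])
  then show ?thesis
    unfolding T R using sw[of j k i l] sw[of i k j l] by linarith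
qed

end

section \<open>The Chern connection in a chart\<close>

locale hermitian_chart =
  fixes A :: "('a::{t2_space,second_countable_topology}, complex^'m) chart set"
    and h :: "('a, complex^'m) chart \<Rightarrow> 'a \<Rightarrow> complex^'m^'m" and c :: "('a, complex^'m) chart"
  assumes M: "hermitian_manifold A h" and c: "c \<in> A"
begin

sublocale M: complex_region c "cdom c"
  using M atlas_chart[of holomorphic_map_on A c] c by unfold_locales (auto simp: hermitian_manifold_def)

abbreviation "K q \<equiv> upper (h c q)"

lemma metric:
  "smooth_on (h c \<circ> cinv c) (cmap c ` cdom c)"
  "\<forall>p\<in>cdom c. (\<forall>\<alpha> \<beta>. h c p $ \<beta> $ \<alpha> = cnj (h c p $ \<alpha> $ \<beta>))
     \<and> (\<forall>v. v \<noteq> 0 \<longrightarrow> Re (\<Sum>\<alpha>\<in>UNIV. \<Sum>\<beta>\<in>UNIV. h c p $ \<alpha> $ \<beta> * v $ \<alpha> * cnj (v $ \<beta>)) > 0)"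
  by (rule bspec[OF conjunct1[OF iffD1[OF hermitian_metric_def
        conjunct2[OF iffD1[OF hermitian_manifold_def M]]]] c, THEN conjunct1])
    (rule bspec[OF conjunct1[OF iffD1[OF hermitian_metric_def
        conjunct2[OF iffD1[OF hermitian_manifold_def M]]]] c, THEN conjunct2])

lemma h_herm: "q \<in> cdom c \<Longrightarrow> h c q $ \<beta> $ \<alpha> = cnj (h c q $ \<alpha> $ \<beta>)"
  using metric by blast

lemma h_invertible: "q \<in> cdom c \<Longrightarrow> invertible (h c q)"
  using metric(2) by (intro invertible_hermitian) blast

lemma K_herm: "q \<in> cdom c \<Longrightarrow> cnj (K q \<alpha> \<beta>) = K q \<beta> \<alpha>"
  by (intro cnj_upper h_invertible h_herm)

lemma h_smooth: "M.region_smooth (\<lambda>q. h c q $ \<alpha> $ \<beta>)"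
proof -
  have "M.region_smooth (h c)"
    using metric(1) by (simp only: M.region_smooth_def)
  then show ?thesis
    by (intro M.region_smooth_linear[OF bounded_linear_compose[OF bounded_linear_vec_nth bounded_linear_vec_nth]])
qed

lemma h_diff: "q \<in> cdom c \<Longrightarrow> chart_diff c (\<lambda>q. h c q $ \<alpha> $ \<beta>) q"
  by (rule M.region_smooth_diff[OF h_smooth])

lemma dh_diff: "q \<in> cdom c \<Longrightarrow> chart_diff c (wirt e c \<gamma> (\<lambda>q. h c q $ \<alpha> $ \<beta>)) q"
  by (rule M.region_smooth_diff[OF M.region_smooth_wirt[OF h_smooth]])

section \<open>Derivatives of the inverse metric and of the Chern symbols\<close>

lemma K_diff: "q \<in> cdom c \<Longrightarrow> chart_diff c (\<lambda>q. K q \<alpha> \<beta>) q"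
  by (intro M.chart_diff_upper h_invertible h_diff)

lemma chern_wirt: "chern h c \<mu> \<alpha> \<gamma> = (\<lambda>p. \<Sum>\<delta>\<in>UNIV. K p \<mu> \<delta> * wirt 1 c \<alpha> (\<lambda>q. h c q $ \<gamma> $ \<delta>) p)"
  by (simp add: fun_eq_iff chern_def pdz_wirt)

lemma chern_diff: "q \<in> cdom c \<Longrightarrow> chart_diff c (chern h c \<mu> \<alpha> \<gamma>) q"
  unfolding chern_wirt by (intro chart_diff_sum chart_diff_mult K_diff dh_diff M.cinv_cmap)

text \<open>Differentiate the relation saying that \<open>K\<close> is inverse to the metric: the
  derivative falling on the metric produces a Chern symbol, and a further contraction with
  \<open>K\<close> isolates the derivative of \<open>K\<close>.\<close>

lemma wirt_K:
  assumes p: "p \<in> cdom c"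
  shows "wirt 1 c \<alpha> (\<lambda>q. K q \<gamma> \<delta>) p = - (\<Sum>\<mu>\<in>UNIV. chern h c \<gamma> \<alpha> \<mu> p * K p \<mu> \<delta>)"
proof -
  note cc = M.cinv_cmap[OF p]
  have 1: "(\<Sum>\<beta>\<in>UNIV. wirt 1 c \<alpha> (\<lambda>q. K q \<gamma> \<beta>) p * h c p $ \<mu> $ \<beta>) = - chern h c \<gamma> \<alpha> \<mu> p" for \<mu>
  proof -
    have "wirt 1 c \<alpha> (\<lambda>q. \<Sum>\<beta>\<in>UNIV. K q \<gamma> \<beta> * h c q $ \<mu> $ \<beta>) p = 0"
      by (subst M.wirt_cong[OF upper_inverse(1)[OF h_invertible] p]) auto
    moreover have "wirt 1 c \<alpha> (\<lambda>q. \<Sum>\<beta>\<in>UNIV. K q \<gamma> \<beta> * h c q $ \<mu> $ \<beta>) p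
        = (\<Sum>\<beta>\<in>UNIV. wirt 1 c \<alpha> (\<lambda>q. K q \<gamma> \<beta>) p * h c p $ \<mu> $ \<beta>) + chern h c \<gamma> \<alpha> \<mu> p"
      by (simp add: wirt_sum wirt_mult chart_diff_mult K_diff h_diff p cc sum.distrib chern_wirt)
    ultimately show ?thesis by (simp add: eq_neg_iff_add_eq_0)
  qed
  have "wirt 1 c \<alpha> (\<lambda>q. K q \<gamma> \<delta>) p
      = (\<Sum>\<beta>\<in>UNIV. wirt 1 c \<alpha> (\<lambda>q. K q \<gamma> \<beta>) p * (\<Sum>\<mu>\<in>UNIV. K p \<mu> \<delta> * h c p $ \<mu> $ \<beta>))"
    by (simp add: upper_inverse(2)[OF h_invertible[OF p]] if_distrib cong: if_cong)
  also have "\<dots> = (\<Sum>\<mu>\<in>UNIV. (\<Sum>\<beta>\<in>UNIV. wirt 1 c \<alpha> (\<lambda>q. K q \<gamma> \<beta>) p * h c p $ \<mu> $ \<beta>) * K p \<mu> \<delta>)"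
    unfolding sum_distrib_left sum_distrib_right by (subst sum.swap) (simp add: mult_ac)
  finally show ?thesis by (simp add: 1 sum_negf)
qed

lemma wirt_bar_K:
  assumes p: "p \<in> cdom c"
  shows "wirt (-1) c \<alpha> (\<lambda>q. K q \<gamma> \<delta>) p = - (\<Sum>\<mu>\<in>UNIV. cnj (chern h c \<delta> \<alpha> \<mu> p) * K p \<gamma> \<mu>)"
proof -
  have "wirt (-1) c \<alpha> (\<lambda>q. K q \<gamma> \<delta>) p = wirt (-1) c \<alpha> (\<lambda>q. cnj (K q \<delta> \<gamma>)) p"
    by (rule M.wirt_cong[OF _ p]) (simp add: K_herm)
  also have "\<dots> = cnj (wirt 1 c \<alpha> (\<lambda>q. K q \<delta> \<gamma>) p)"
    by (simp add: wirt_cnj K_diff p)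
  finally show ?thesis by (simp add: wirt_K p K_herm)
qed

lemma wirt_bar_h:
  assumes q: "q \<in> cdom c"
  shows "wirt (-1) c \<beta> (\<lambda>q. h c q $ \<nu> $ \<delta>) q = cnj (wirt 1 c \<beta> (\<lambda>q. h c q $ \<delta> $ \<nu>) q)"
proof -
  have "wirt (-1) c \<beta> (\<lambda>q. h c q $ \<nu> $ \<delta>) q = wirt (-1) c \<beta> (\<lambda>q. cnj (h c q $ \<delta> $ \<nu>)) q"
    by (rule M.wirt_cong[OF h_herm q])
  then show ?thesis by (simp add: wirt_cnj h_diff q)
qed

text \<open>Curvature appears when a connection form of type (1,0) is differentiated in the opposite
  direction; here both are conjugated. The conjugate symbol is \<open>K\<close> times a barred
  derivative of \<open>h\<close>, and the two product-rule terms are the two terms of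
  \<open>RM\<close> with one index raised.\<close>

lemma wirt_cnj_chern:
  assumes p: "p \<in> cdom c"
  shows "wirt 1 c \<alpha> (\<lambda>q. cnj (chern h c \<mu> \<beta> \<delta> q)) p = - (\<Sum>\<gamma>\<in>UNIV. K p \<gamma> \<mu> * RM h c \<alpha> \<beta> \<gamma> \<delta> p)"
proof -
  let ?H = "\<lambda>\<nu> \<delta> q. h c q $ \<nu> $ \<delta>"
  note cc = M.cinv_cmap[OF p]
  have "cnj (chern h c \<mu> \<beta> \<delta> q) = (\<Sum>\<nu>\<in>UNIV. K q \<nu> \<mu> * wirt (-1) c \<beta> (?H \<nu> \<delta>) q)" if q: "q \<in> cdom c" for q
  proof -
    show ?thesis by (simp add: chern_wirt K_herm wirt_bar_h q)
  qed
  then have "wirt 1 c \<alpha> (\<lambda>q. cnj (chern h c \<mu> \<beta> \<delta> q)) p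
      = wirt 1 c \<alpha> (\<lambda>q. \<Sum>\<nu>\<in>UNIV. K q \<nu> \<mu> * wirt (-1) c \<beta> (?H \<nu> \<delta>) q) p"
    by (rule M.wirt_cong[OF _ p])
  also have "\<dots> = (\<Sum>\<nu>\<in>UNIV. wirt 1 c \<alpha> (\<lambda>q. K q \<nu> \<mu>) p * wirt (-1) c \<beta> (?H \<nu> \<delta>) p)
      + (\<Sum>\<nu>\<in>UNIV. K p \<nu> \<mu> * wirt 1 c \<alpha> (wirt (-1) c \<beta> (?H \<nu> \<delta>)) p)"
    by (simp add: wirt_sum wirt_mult chart_diff_mult K_diff dh_diff p cc sum.distrib)
  also have "(\<Sum>\<nu>\<in>UNIV. wirt 1 c \<alpha> (\<lambda>q. K q \<nu> \<mu>) p * wirt (-1) c \<beta> (?H \<nu> \<delta>) p)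
      = - (\<Sum>\<nu>\<in>UNIV. \<Sum>\<gamma>\<in>UNIV. \<Sum>\<kappa>\<in>UNIV.
          K p \<gamma> \<mu> * (K p \<nu> \<kappa> * wirt 1 c \<alpha> (?H \<gamma> \<kappa>) p * wirt (-1) c \<beta> (?H \<nu> \<delta>) p))"
    by (simp add: wirt_K[OF p] chern_wirt sum_distrib_left sum_distrib_right sum_negf mult_ac)
  also have "\<dots> = - (\<Sum>\<gamma>\<in>UNIV. \<Sum>\<nu>\<in>UNIV. \<Sum>\<kappa>\<in>UNIV.
          K p \<gamma> \<mu> * (K p \<nu> \<kappa> * wirt 1 c \<alpha> (?H \<gamma> \<kappa>) p * wirt (-1) c \<beta> (?H \<nu> \<delta>) p))"
    by (subst sum.swap) simp
  finally show ?thesis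
    by (simp add: RM_def pdz_wirt pdzbar_wirt sum_distrib_left sum.distrib algebra_simps sum_subtractf sum_negf)
qed

end

section \<open>Pluri-harmonic maps\<close>

text \<open>On the vectors \<open>axis \<alpha> 1\<close> and \<open>axis \<beta> x\<close> the form
  involves both \<open>a \<alpha> \<beta>\<close> and \<open>a \<beta> \<alpha>\<close>; taking
  \<open>x = 1\<close> gives their difference and \<open>x = \<i>\<close> their sum, up to a
  factor.\<close>

lemma form11_eq_0D:
  assumes "\<And>v w. form11 a v w = 0"
  shows "a \<alpha> \<beta> = 0"
proof -
  have "form11 a (axis \<alpha> 1) (axis \<beta> x) = a \<alpha> \<beta> * cnj x - a \<beta> \<alpha> * x" for x
  proof -
    have *: "a \<alpha>' \<beta>' * wedge (\<lambda>v. v $ \<alpha>') (\<lambda>v. cnj (v $ \<beta>')) (axis \<alpha> 1) (axis \<beta> x)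
        = (if \<beta>' = \<beta> then if \<alpha>' = \<alpha> then a \<alpha> \<beta> * cnj x else 0 else 0)
          - (if \<beta>' = \<alpha> then if \<alpha>' = \<beta> then a \<beta> \<alpha> * x else 0 else 0)" for \<alpha>' \<beta>'
      by (auto simp: wedge_def axis_def algebra_simps)
    show ?thesis unfolding form11_def * by (simp add: sum_subtractf)
  qed
  from this[of 1] this[of \<i>] have "a \<alpha> \<beta> - a \<beta> \<alpha> = 0" "- \<i> * (a \<alpha> \<beta> + a \<beta> \<alpha>) = 0"
    using assms by (simp_all add: algebra_simps)
  then show ?thesis by simp
qed

lemma form11_add: "form11 a v w + form11 b v w = form11 (\<lambda>\<alpha> \<beta>. a \<alpha> \<beta> + b \<alpha> \<beta>) v w"
  by (simp add: form11_def sum.distrib ring_distribs)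

text \<open>The Leibniz rule for a metric connection: \<open>dK\<close> and \<open>dG\<close> are the derivatives of the
  coefficients of the metric and \<open>P\<close>, \<open>Q\<close>, \<open>C\<close> the connection matrices.\<close>

lemma leibniz_algebra:
  fixes K :: "'m::finite \<Rightarrow> 'm \<Rightarrow> complex" and G :: "'n::finite \<Rightarrow> 'n \<Rightarrow> complex"
  assumes dK: "\<And>\<gamma> \<delta>. dK \<gamma> \<delta> = - (\<Sum>\<mu>\<in>UNIV. P \<gamma> \<mu> * K \<mu> \<delta>) - (\<Sum>\<mu>\<in>UNIV. Q \<delta> \<mu> * K \<gamma> \<mu>)"
    and dG: "\<And>i j. dG i j = (\<Sum>l\<in>UNIV. C l i * G l j) + (\<Sum>l\<in>UNIV. C l j * G i l)"
  shows "(\<Sum>\<gamma>\<in>UNIV. \<Sum>\<delta>\<in>UNIV. \<Sum>i\<in>UNIV. \<Sum>j\<in>UNIV.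
      dK \<gamma> \<delta> * G i j * S \<gamma> i * T \<delta> j + K \<gamma> \<delta> * dG i j * S \<gamma> i * T \<delta> j
      + K \<gamma> \<delta> * G i j * dS \<gamma> i * T \<delta> j + K \<gamma> \<delta> * G i j * S \<gamma> i * dT \<delta> j)
    = (\<Sum>\<gamma>\<in>UNIV. \<Sum>\<delta>\<in>UNIV. \<Sum>i\<in>UNIV. \<Sum>j\<in>UNIV.
        K \<gamma> \<delta> * G i j * (dS \<gamma> i - (\<Sum>\<mu>\<in>UNIV. P \<mu> \<gamma> * S \<mu> i) + (\<Sum>k\<in>UNIV. C i k * S \<gamma> k)) * T \<delta> j)
    + (\<Sum>\<gamma>\<in>UNIV. \<Sum>\<delta>\<in>UNIV. \<Sum>i\<in>UNIV. \<Sum>j\<in>UNIV.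
        K \<gamma> \<delta> * G i j * S \<gamma> i * (dT \<delta> j - (\<Sum>\<mu>\<in>UNIV. Q \<mu> \<delta> * T \<mu> j) + (\<Sum>k\<in>UNIV. C j k * T \<delta> k)))"
proof -
  \<comment> \<open>Each of the four identities only renames bound indices: exchanging the
    contracted index with the index of the section moves the connection matrix from the metric onto
    \<open>S\<close> or \<open>T\<close>.\<close>
  have 1: "(\<Sum>\<gamma>\<in>UNIV. \<Sum>\<delta>\<in>UNIV. \<Sum>i\<in>UNIV. \<Sum>j\<in>UNIV. (\<Sum>\<mu>\<in>UNIV. P \<gamma> \<mu> * K \<mu> \<delta>) * G i j * S \<gamma> i * T \<delta> j)
      = (\<Sum>\<gamma>\<in>UNIV. \<Sum>\<delta>\<in>UNIV. \<Sum>i\<in>UNIV. \<Sum>j\<in>UNIV. K \<gamma> \<delta> * G i j * (\<Sum>\<mu>\<in>UNIV. P \<mu> \<gamma> * S \<mu> i) * T \<delta> j)"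
    unfolding sum_distrib_left sum_distrib_right sum.cartesian_product
    by (rule sum.reindex_bij_witness[of _ "\<lambda>(\<gamma>, \<delta>, i, j, \<mu>). (\<mu>, \<delta>, i, j, \<gamma>)" "\<lambda>(\<gamma>, \<delta>, i, j, \<mu>). (\<mu>, \<delta>, i, j, \<gamma>)"])
      auto
  have 2: "(\<Sum>\<gamma>\<in>UNIV. \<Sum>\<delta>\<in>UNIV. \<Sum>i\<in>UNIV. \<Sum>j\<in>UNIV. (\<Sum>\<mu>\<in>UNIV. Q \<delta> \<mu> * K \<gamma> \<mu>) * G i j * S \<gamma> i * T \<delta> j)
      = (\<Sum>\<gamma>\<in>UNIV. \<Sum>\<delta>\<in>UNIV. \<Sum>i\<in>UNIV. \<Sum>j\<in>UNIV. K \<gamma> \<delta> * G i j * S \<gamma> i * (\<Sum>\<mu>\<in>UNIV. Q \<mu> \<delta> * T \<mu> j))"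
    unfolding sum_distrib_left sum_distrib_right sum.cartesian_product
    by (rule sum.reindex_bij_witness[of _ "\<lambda>(\<gamma>, \<delta>, i, j, \<mu>). (\<gamma>, \<mu>, i, j, \<delta>)" "\<lambda>(\<gamma>, \<delta>, i, j, \<mu>). (\<gamma>, \<mu>, i, j, \<delta>)"])
      auto
  have 3: "(\<Sum>\<gamma>\<in>UNIV. \<Sum>\<delta>\<in>UNIV. \<Sum>i\<in>UNIV. \<Sum>j\<in>UNIV. K \<gamma> \<delta> * (\<Sum>l\<in>UNIV. C l i * G l j) * S \<gamma> i * T \<delta> j)
      = (\<Sum>\<gamma>\<in>UNIV. \<Sum>\<delta>\<in>UNIV. \<Sum>i\<in>UNIV. \<Sum>j\<in>UNIV. K \<gamma> \<delta> * G i j * (\<Sum>k\<in>UNIV. C i k * S \<gamma> k) * T \<delta> j)"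
    unfolding sum_distrib_left sum_distrib_right sum.cartesian_product
    by (rule sum.reindex_bij_witness[of _ "\<lambda>(\<gamma>, \<delta>, i, j, k). (\<gamma>, \<delta>, k, j, i)" "\<lambda>(\<gamma>, \<delta>, i, j, k). (\<gamma>, \<delta>, k, j, i)"])
      auto
  have 4: "(\<Sum>\<gamma>\<in>UNIV. \<Sum>\<delta>\<in>UNIV. \<Sum>i\<in>UNIV. \<Sum>j\<in>UNIV. K \<gamma> \<delta> * (\<Sum>l\<in>UNIV. C l j * G i l) * S \<gamma> i * T \<delta> j)
      = (\<Sum>\<gamma>\<in>UNIV. \<Sum>\<delta>\<in>UNIV. \<Sum>i\<in>UNIV. \<Sum>j\<in>UNIV. K \<gamma> \<delta> * G i j * S \<gamma> i * (\<Sum>k\<in>UNIV. C j k * T \<delta> k))"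
    unfolding sum_distrib_left sum_distrib_right sum.cartesian_product
    by (rule sum.reindex_bij_witness[of _ "\<lambda>(\<gamma>, \<delta>, i, j, k). (\<gamma>, \<delta>, i, k, j)" "\<lambda>(\<gamma>, \<delta>, i, j, k). (\<gamma>, \<delta>, i, k, j)"])
      auto
  show ?thesis
    unfolding dK dG ring_distribs sum.distrib sum_subtractf minus_mult_left[symmetric] sum_negf
      1 2 3 4 by simp
qed

locale pluriharmonic_chart = M: hermitian_chart A h c + N: riemannian_chart B g d
  for A :: "('a::{t2_space,second_countable_topology}, complex^'m) chart set" and h c
    and B :: "('b::{t2_space,second_countable_topology}, real^'n) chart set" and g d +
  fixes f :: "'a \<Rightarrow> 'b"
  assumes f_smooth: "smooth_map A B f" and f_pluriharmonic: "pluriharmonic A B g f"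
begin

abbreviation "W \<equiv> cdom c \<inter> f -` cdom d"

sublocale W: complex_region c W
proof
  have "open (f -` cdom d)"
    using f_smooth atlas_chart(1)[of smooth_on B d] N.N N.d
    by (intro open_vimage) (auto simp: smooth_map_def riemannian_manifold_def)
  then show "open (cmap c ` W)"
    using atlas_chart(5)[of holomorphic_map_on A c] M.M M.c by (simp add: hermitian_manifold_def)
qed (auto intro: M.M.cinv_cmap)

abbreviation "K \<gamma> \<delta> q \<equiv> upper (h c q) \<gamma> \<delta>"
abbreviation "G i j q \<equiv> complex_of_real (g d (f q) $ i $ j)"
abbreviation "\<Gamma> i j k q \<equiv> complex_of_real (christoffel g d i j k (f q))"
abbreviation "y \<equiv> coord_f d f"
text \<open>The matrix of the pulled-back Levi-Civita connection on the complexified bundle, in the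
  direction of \<open>z^\<alpha>\<close> for \<open>e = 1\<close> and of its conjugate for
  \<open>e = -1\<close>.\<close>

abbreviation "conn e \<alpha> i k q \<equiv> (\<Sum>j\<in>UNIV. \<Gamma> i j k q * wirt e c \<alpha> (y j) q)"
abbreviation "s \<gamma> i \<equiv> wirt 1 c \<gamma> (y i)"
abbreviation "sbar \<gamma> i \<equiv> wirt (-1) c \<gamma> (y i)"

section \<open>Derivatives of the data pulled back along the map\<close>

lemma f_diff:
  assumes "p \<in> W"
  shows "(cmap d \<circ> f \<circ> cinv c) differentiable (at (cmap c p))"
  using f_smooth assms M.c N.d
  by (intro smooth_on_differentiable[of _ "cmap c ` W"]) (auto simp: smooth_map_def)

lemma y_smooth: "W.region_smooth (y i)"
proof -
  have "smooth_on (cmap d \<circ> f \<circ> cinv c) (cmap c ` W)"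
    using f_smooth M.c N.d by (auto simp: smooth_map_def)
  then have "W.region_smooth (\<lambda>q. cmap d (f q))" by (simp add: W.region_smooth_def o_def)
  from W.region_smooth_linear[OF bounded_linear_compose[OF bounded_linear_of_real bounded_linear_vec_nth] this]
  show ?thesis by (simp add: coord_f_def[abs_def])
qed

lemmas wirt_y_smooth = W.region_smooth_wirt[OF y_smooth]
lemmas wirt_y_diff = W.region_smooth_diff[OF wirt_y_smooth]
lemmas wirt_wirt_y_diff = W.region_smooth_diff[OF W.region_smooth_wirt[OF wirt_y_smooth]]

lemma cnj_wirt_y: "p \<in> W \<Longrightarrow> cnj (s \<gamma> i p) = sbar \<gamma> i p" "p \<in> W \<Longrightarrow> cnj (sbar \<gamma> i p) = s \<gamma> i p"
  using wirt_cnj[of c "y i" p 1 \<gamma>] wirt_cnj[of c "y i" p "-1" \<gamma>] W.region_smooth_diff[OF y_smooth, of p i]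
  by (simp_all add: coord_f_def[abs_def])

lemma
  assumes p: "p \<in> W" and \<phi>: "\<And>q. q \<in> cdom d \<Longrightarrow> chart_diff d \<phi> q"
  shows pullback_diff: "chart_diff c (\<lambda>q. complex_of_real (\<phi> (f q))) p"
    and wirt_pullback': "wirt e c \<alpha> (\<lambda>q. complex_of_real (\<phi> (f q))) p
      = (\<Sum>k\<in>UNIV. of_real (pdy d k \<phi> (f p)) * wirt e c \<alpha> (y k) p)"
  using chart_diff_pullback[OF W.complex_region_axioms p N.N.chart_region_axioms _ f_diff[OF p] \<phi>]
    wirt_pullback[OF W.complex_region_axioms p N.N.chart_region_axioms _ f_diff[OF p] \<phi>] p by auto

lemma G_diff: "p \<in> W \<Longrightarrow> chart_diff c (G i j) p"
  by (rule pullback_diff[OF _ N.g_diff])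

lemma \<Gamma>_diff: "p \<in> W \<Longrightarrow> chart_diff c (\<Gamma> i j k) p"
  by (rule pullback_diff[OF _ N.christoffel_diff])

lemma conn_diff: "p \<in> W \<Longrightarrow> chart_diff c (conn e \<alpha> i k) p"
  by (intro chart_diff_sum chart_diff_mult \<Gamma>_diff wirt_y_diff W.cinv_cmap)

lemma \<Gamma>_sym: "p \<in> W \<Longrightarrow> \<Gamma> i j k p = \<Gamma> i k j p"
  using levi_civita_torsion_free[OF N.N N.d] by simp

text \<open>The metric property of the Levi-Civita connection, pulled back by the chain rule; it
  holds in barred and unbarred directions alike.\<close>

lemma wirt_G:
  assumes p: "p \<in> W"
  shows "wirt e c \<alpha> (G i j) p = (\<Sum>l\<in>UNIV. conn e \<alpha> l i p * G l j p) + (\<Sum>l\<in>UNIV. conn e \<alpha> l j p * G i l p)"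
proof -
  have q: "f p \<in> cdom d" using p by simp
  have "wirt e c \<alpha> (G i j) p = (\<Sum>k\<in>UNIV. \<Sum>l\<in>UNIV. \<Gamma> l k i p * wirt e c \<alpha> (y k) p * G l j p)
      + (\<Sum>k\<in>UNIV. \<Sum>l\<in>UNIV. \<Gamma> l k j p * wirt e c \<alpha> (y k) p * G l i p)"
    by (simp add: wirt_pullback'[OF p N.g_diff] levi_civita_metric[OF N.N N.d q] sum.distrib
        sum_distrib_left sum_distrib_right algebra_simps)
  also have "\<dots> = (\<Sum>l\<in>UNIV. conn e \<alpha> l i p * G l j p) + (\<Sum>l\<in>UNIV. conn e \<alpha> l j p * G l i p)"
    unfolding sum_distrib_right by (subst (1 2) sum.swap) simp
  finally show ?thesis by (simp add: N.g_sym[OF q, of _ i])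
qed

lemma wirt_conn:
  assumes p: "p \<in> W"
  shows "wirt e c \<alpha> (conn e' \<beta> i k) p
    = (\<Sum>a\<in>UNIV. \<Sum>l\<in>UNIV. of_real (pdy d a (christoffel g d i l k) (f p)) * wirt e c \<alpha> (y a) p * wirt e' c \<beta> (y l) p)
      + (\<Sum>l\<in>UNIV. \<Gamma> i l k p * wirt e c \<alpha> (wirt e' c \<beta> (y l)) p)"
proof -
  have "wirt e c \<alpha> (conn e' \<beta> i k) p
    = (\<Sum>l\<in>UNIV. \<Sum>a\<in>UNIV. of_real (pdy d a (christoffel g d i l k) (f p)) * wirt e c \<alpha> (y a) p * wirt e' c \<beta> (y l) p)
      + (\<Sum>l\<in>UNIV. \<Gamma> i l k p * wirt e c \<alpha> (wirt e' c \<beta> (y l)) p)"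
    by (simp add: wirt_sum wirt_mult chart_diff_mult \<Gamma>_diff[OF p] wirt_y_diff[OF p] W.cinv_cmap[OF p]
        wirt_pullback'[OF p N.christoffel_diff] sum.distrib sum_distrib_right)
  then show ?thesis by (subst sum.swap)
qed

text \<open>One equation read in two ways: the section \<open>s\<close> is parallel in barred
  directions and its conjugate \<open>sbar\<close> in unbarred ones. The readings are linked by
  commuting derivatives and by the symmetry of the Christoffel symbols.\<close>

lemma pluriharmonic_eq:
  assumes p: "p \<in> W"
  shows "wirt (-1) c \<beta> (s \<alpha> i) p = - (\<Sum>k\<in>UNIV. conn (-1) \<beta> i k p * s \<alpha> k p)"
    and "wirt 1 c \<alpha> (sbar \<beta> i) p = - (\<Sum>k\<in>UNIV. conn 1 \<alpha> i k p * sbar \<beta> k p)"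
proof -
  let ?a = "\<lambda>\<alpha> \<beta>. wirt 1 c \<alpha> (sbar \<beta> i) p + (\<Sum>j\<in>UNIV. \<Sum>k\<in>UNIV. \<Gamma> i j k p * sbar \<beta> j p * s \<alpha> k p)"
  have "form11 ?a v w = 0" for v w
    using f_pluriharmonic M.c N.d p unfolding pluriharmonic_def pdz_wirt pdzbar_wirt by blast
  then have "?a \<alpha> \<beta> = 0" by (rule form11_eq_0D)
  then have 1: "wirt 1 c \<alpha> (sbar \<beta> i) p = - (\<Sum>j\<in>UNIV. \<Sum>k\<in>UNIV. \<Gamma> i j k p * sbar \<beta> j p * s \<alpha> k p)"
    by (simp add: eq_neg_iff_add_eq_0)
  show "wirt (-1) c \<beta> (s \<alpha> i) p = - (\<Sum>k\<in>UNIV. conn (-1) \<beta> i k p * s \<alpha> k p)"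
    unfolding W.wirt_commute[OF y_smooth p, of "-1"] 1 sum_distrib_right by (subst sum.swap) simp
  show "wirt 1 c \<alpha> (sbar \<beta> i) p = - (\<Sum>k\<in>UNIV. conn 1 \<alpha> i k p * sbar \<beta> k p)"
    unfolding 1 sum_distrib_right by (subst \<Gamma>_sym[OF p]) (simp add: mult_ac)
qed

text \<open>The matrices \<open>P\<close> and \<open>Q\<close> are left free so that one rule covers
  both types of derivative: the Chern connection sits in \<open>P\<close> for unbarred and in
  \<open>Q\<close> for barred directions.\<close>

lemma leibniz:
  assumes p: "p \<in> W"
    and S: "\<And>\<gamma> i. chart_diff c (S \<gamma> i) p" and T: "\<And>\<gamma> i. chart_diff c (T \<gamma> i) p"
    and dK: "\<And>\<gamma> \<delta>. wirt e c \<alpha> (K \<gamma> \<delta>) p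
      = - (\<Sum>\<mu>\<in>UNIV. P \<gamma> \<mu> * K \<mu> \<delta> p) - (\<Sum>\<mu>\<in>UNIV. Q \<delta> \<mu> * K \<gamma> \<mu> p)"
  shows "wirt e c \<alpha> (\<lambda>q. \<Sum>\<gamma>\<in>UNIV. \<Sum>\<delta>\<in>UNIV. \<Sum>i\<in>UNIV. \<Sum>j\<in>UNIV. K \<gamma> \<delta> q * G i j q * S \<gamma> i q * T \<delta> j q) p
    = (\<Sum>\<gamma>\<in>UNIV. \<Sum>\<delta>\<in>UNIV. \<Sum>i\<in>UNIV. \<Sum>j\<in>UNIV. K \<gamma> \<delta> p * G i j p
        * (wirt e c \<alpha> (S \<gamma> i) p - (\<Sum>\<mu>\<in>UNIV. P \<mu> \<gamma> * S \<mu> i p) + (\<Sum>k\<in>UNIV. conn e \<alpha> i k p * S \<gamma> k p)) * T \<delta> j p)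
    + (\<Sum>\<gamma>\<in>UNIV. \<Sum>\<delta>\<in>UNIV. \<Sum>i\<in>UNIV. \<Sum>j\<in>UNIV. K \<gamma> \<delta> p * G i j p * S \<gamma> i p
        * (wirt e c \<alpha> (T \<delta> j) p - (\<Sum>\<mu>\<in>UNIV. Q \<mu> \<delta> * T \<mu> j p) + (\<Sum>k\<in>UNIV. conn e \<alpha> j k p * T \<delta> k p)))"
proof -
  have pc: "p \<in> cdom c" and cc: "cinv c (cmap c p) = p" using p W.cinv_cmap[OF p] by auto
  note diffs = chart_diff_sum chart_diff_mult M.K_diff[OF pc] G_diff[OF p] S T cc
  have "wirt e c \<alpha> (\<lambda>q. \<Sum>\<gamma>\<in>UNIV. \<Sum>\<delta>\<in>UNIV. \<Sum>i\<in>UNIV. \<Sum>j\<in>UNIV. K \<gamma> \<delta> q * G i j q * S \<gamma> i q * T \<delta> j q) p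
    = (\<Sum>\<gamma>\<in>UNIV. \<Sum>\<delta>\<in>UNIV. \<Sum>i\<in>UNIV. \<Sum>j\<in>UNIV.
      wirt e c \<alpha> (K \<gamma> \<delta>) p * G i j p * S \<gamma> i p * T \<delta> j p + K \<gamma> \<delta> p * wirt e c \<alpha> (G i j) p * S \<gamma> i p * T \<delta> j p
      + K \<gamma> \<delta> p * G i j p * wirt e c \<alpha> (S \<gamma> i) p * T \<delta> j p + K \<gamma> \<delta> p * G i j p * S \<gamma> i p * wirt e c \<alpha> (T \<delta> j) p)"
    by (simp add: wirt_sum wirt_mult diffs ring_distribs)
  also note leibniz_algebra[OF dK wirt_G[OF p]]
  finally show ?thesis .
qed

section \<open>The barred Hessian and its derivative\<close>

abbreviation "hess \<beta> \<delta> j q \<equiv>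
  wirt (-1) c \<beta> (sbar \<delta> j) q + (\<Sum>k\<in>UNIV. conn (-1) \<beta> j k q * sbar \<delta> k q)"

text \<open>The full covariant derivative of \<open>sbar\<close> in a barred direction. The part
  \<open>hess\<close>, without Chern symbols, is split off because it is symmetric in its two lower
  indices, whereas the Chern connection may have torsion.\<close>

abbreviation "nabla_sbar \<beta> \<delta> j q \<equiv>
  hess \<beta> \<delta> j q - (\<Sum>\<mu>\<in>UNIV. cnj (chern h c \<mu> \<beta> \<delta> q) * sbar \<mu> j q)"

lemma hess_sym:
  assumes p: "p \<in> W"
  shows "hess \<beta> \<delta> j p = hess \<delta> \<beta> j p"
proof -
  have "(\<Sum>k\<in>UNIV. conn (-1) \<beta> j k p * sbar \<delta> k p) = (\<Sum>k\<in>UNIV. conn (-1) \<delta> j k p * sbar \<beta> k p)"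
    unfolding sum_distrib_right by (subst \<Gamma>_sym[OF p], subst sum.swap) (simp add: mult_ac)
  then show ?thesis using W.wirt_commute[OF y_smooth p, of "-1" \<beta> "-1" \<delta>] by simp
qed

lemma hess_diff: "p \<in> W \<Longrightarrow> chart_diff c (hess \<beta> \<delta> j) p"
  by (intro chart_diff_add chart_diff_sum chart_diff_mult conn_diff wirt_wirt_y_diff wirt_y_diff W.cinv_cmap)

text \<open>Exchanging the two lower indices of the Hessian first makes the curvature appear with the
  index order of the statement, without the first Bianchi identity.\<close>

lemma wirt_hess:
  assumes p: "p \<in> W"
  shows "wirt 1 c \<alpha> (hess \<beta> \<delta> j) p + (\<Sum>k\<in>UNIV. conn 1 \<alpha> j k p * hess \<beta> \<delta> k p)
    = (\<Sum>k\<in>UNIV. \<Sum>a\<in>UNIV. \<Sum>l\<in>UNIV.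
        of_real (curv g d a l k j (f p)) * s \<alpha> a p * sbar \<delta> l p * sbar \<beta> k p)"
proof -
  have cc: "cinv c (cmap c p) = p" by (rule W.cinv_cmap[OF p])
  note d = wirt_y_diff[OF p] conn_diff[OF p]
  let ?D = "\<lambda>a l k. complex_of_real (pdy d a (christoffel g d j l k) (f p))"
  have 1: "wirt 1 c \<alpha> (hess \<beta> \<delta> j) p = wirt 1 c \<alpha> (wirt (-1) c \<delta> (sbar \<beta> j)) p
      + (\<Sum>k\<in>UNIV. wirt 1 c \<alpha> (conn (-1) \<delta> j k) p * sbar \<beta> k p)
      + (\<Sum>k\<in>UNIV. conn (-1) \<delta> j k p * wirt 1 c \<alpha> (sbar \<beta> k) p)"
  proof -
    have "wirt 1 c \<alpha> (hess \<beta> \<delta> j) p = wirt 1 c \<alpha> (hess \<delta> \<beta> j) p"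
      by (rule W.wirt_cong[OF hess_sym p])
    also have "\<dots> = wirt 1 c \<alpha> (wirt (-1) c \<delta> (sbar \<beta> j)) p
        + wirt 1 c \<alpha> (\<lambda>q. \<Sum>k\<in>UNIV. conn (-1) \<delta> j k q * sbar \<beta> k q) p"
      by (intro wirt_add chart_diff_sum chart_diff_mult d wirt_wirt_y_diff[OF p] cc)
    also have "wirt 1 c \<alpha> (\<lambda>q. \<Sum>k\<in>UNIV. conn (-1) \<delta> j k q * sbar \<beta> k q) p
        = (\<Sum>k\<in>UNIV. wirt 1 c \<alpha> (\<lambda>q. conn (-1) \<delta> j k q * sbar \<beta> k q) p)"
      by (intro wirt_sum chart_diff_mult d cc)
    also have "\<dots> = (\<Sum>k\<in>UNIV. wirt 1 c \<alpha> (conn (-1) \<delta> j k) p * sbar \<beta> k p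
        + conn (-1) \<delta> j k p * wirt 1 c \<alpha> (sbar \<beta> k) p)"
      by (intro sum.cong refl wirt_mult d cc)
    finally show ?thesis by (simp only: sum.distrib add.assoc)
  qed
  \<comment> \<open>Commuting the outer derivatives brings the mixed second derivative inside, where
    pluri-harmonicity turns it into an expression of first order; only then is it
    differentiated.\<close>
  have 2: "wirt 1 c \<alpha> (wirt (-1) c \<delta> (sbar \<beta> j)) p
      = - (\<Sum>k\<in>UNIV. wirt (-1) c \<delta> (conn 1 \<alpha> j k) p * sbar \<beta> k p)
        - (\<Sum>k\<in>UNIV. conn 1 \<alpha> j k p * wirt (-1) c \<delta> (sbar \<beta> k) p)"
  proof -
    have "wirt 1 c \<alpha> (wirt (-1) c \<delta> (sbar \<beta> j)) p = wirt (-1) c \<delta> (wirt 1 c \<alpha> (sbar \<beta> j)) p"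
      by (rule W.wirt_commute[OF wirt_y_smooth p])
    also have "\<dots> = wirt (-1) c \<delta> (\<lambda>q. - (\<Sum>k\<in>UNIV. conn 1 \<alpha> j k q * sbar \<beta> k q)) p"
      by (rule W.wirt_cong[OF pluriharmonic_eq(2) p])
    also have "\<dots> = - wirt (-1) c \<delta> (\<lambda>q. \<Sum>k\<in>UNIV. conn 1 \<alpha> j k q * sbar \<beta> k q) p"
      by (intro wirt_minus chart_diff_sum chart_diff_mult d cc)
    also have "wirt (-1) c \<delta> (\<lambda>q. \<Sum>k\<in>UNIV. conn 1 \<alpha> j k q * sbar \<beta> k q) p
        = (\<Sum>k\<in>UNIV. wirt (-1) c \<delta> (\<lambda>q. conn 1 \<alpha> j k q * sbar \<beta> k q) p)"
      by (intro wirt_sum chart_diff_mult d cc)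
    also have "\<dots> = (\<Sum>k\<in>UNIV. wirt (-1) c \<delta> (conn 1 \<alpha> j k) p * sbar \<beta> k p
        + conn 1 \<alpha> j k p * wirt (-1) c \<delta> (sbar \<beta> k) p)"
      by (intro sum.cong refl wirt_mult d cc)
    finally show ?thesis by (simp only: sum.distrib minus_add_distrib diff_conv_add_uminus)
  qed
  \<comment> \<open>The second derivatives of the coordinates of \<open>f\<close> are common to both
    terms and cancel, leaving derivatives of Christoffel symbols.\<close>
  have 3: "wirt 1 c \<alpha> (conn (-1) \<delta> j k) p - wirt (-1) c \<delta> (conn 1 \<alpha> j k) p
      = (\<Sum>a\<in>UNIV. \<Sum>l\<in>UNIV. (?D a l k - ?D l a k) * s \<alpha> a p * sbar \<delta> l p)" for k
  proof -
    have "(\<Sum>a\<in>UNIV. \<Sum>l\<in>UNIV. ?D a l k * sbar \<delta> a p * s \<alpha> l p)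
        = (\<Sum>a\<in>UNIV. \<Sum>l\<in>UNIV. ?D l a k * s \<alpha> a p * sbar \<delta> l p)"
      by (subst sum.swap) (simp add: mult_ac)
    then show ?thesis
      unfolding wirt_conn[OF p] W.wirt_commute[OF y_smooth p, of "-1" \<delta> 1 \<alpha>]
      by (simp add: left_diff_distrib sum_subtractf)
  qed
  have 4: "(\<Sum>k\<in>UNIV. conn 1 \<alpha> j k p * (\<Sum>m\<in>UNIV. conn (-1) \<delta> k m p * sbar \<beta> m p))
      = (\<Sum>k\<in>UNIV. \<Sum>a\<in>UNIV. \<Sum>l\<in>UNIV. (\<Sum>m\<in>UNIV. \<Gamma> j a m p * \<Gamma> m l k p) * s \<alpha> a p * sbar \<delta> l p * sbar \<beta> k p)"
    unfolding sum_distrib_left sum_distrib_right unfolding sum.cartesian_product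
    by (rule sum.reindex_bij_witness[of _ "\<lambda>(k, a, l, m). (m, k, l, a)" "\<lambda>(m, k, l, a). (k, a, l, m)"])
      auto
  have 5: "(\<Sum>k\<in>UNIV. conn (-1) \<delta> j k p * (\<Sum>m\<in>UNIV. conn 1 \<alpha> k m p * sbar \<beta> m p))
      = (\<Sum>k\<in>UNIV. \<Sum>a\<in>UNIV. \<Sum>l\<in>UNIV. (\<Sum>m\<in>UNIV. \<Gamma> j l m p * \<Gamma> m a k p) * s \<alpha> a p * sbar \<delta> l p * sbar \<beta> k p)"
    unfolding sum_distrib_left sum_distrib_right unfolding sum.cartesian_product
    by (rule sum.reindex_bij_witness[of _ "\<lambda>(k, a, l, m). (m, k, a, l)" "\<lambda>(m, k, a, l). (k, a, l, m)"])
      auto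
  \<comment> \<open>The terms with \<open>conn 1\<close> times a barred derivative of
    \<open>sbar\<close> cancel. What is left is the commutator of the covariant derivatives in
    directions \<open>\<alpha>\<close> and barred \<open>\<delta>\<close>, applied to
    \<open>sbar \<beta>\<close>: derivative terms from 3, quadratic terms from 4 and 5.\<close>
  have "wirt 1 c \<alpha> (hess \<beta> \<delta> j) p + (\<Sum>k\<in>UNIV. conn 1 \<alpha> j k p * hess \<beta> \<delta> k p)
    = (\<Sum>k\<in>UNIV. (wirt 1 c \<alpha> (conn (-1) \<delta> j k) p - wirt (-1) c \<delta> (conn 1 \<alpha> j k) p) * sbar \<beta> k p)
      - (\<Sum>k\<in>UNIV. conn (-1) \<delta> j k p * (\<Sum>m\<in>UNIV. conn 1 \<alpha> k m p * sbar \<beta> m p))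
      + (\<Sum>k\<in>UNIV. conn 1 \<alpha> j k p * (\<Sum>m\<in>UNIV. conn (-1) \<delta> k m p * sbar \<beta> m p))"
    unfolding 1 2 hess_sym[OF p, of \<beta> \<delta>] pluriharmonic_eq(2)[OF p]
    by (simp only: sum.distrib sum_subtractf distrib_left left_diff_distrib mult_minus_right sum_negf) simp
  then show ?thesis
    unfolding 3 4 5 curv_def
    by (simp add: sum_distrib_right left_diff_distrib distrib_right sum.distrib sum_subtractf)
qed

section \<open>Covariant derivatives of the section and the derivatives of the energy
  density\<close>

lemma del_F_eq:
  assumes p: "p \<in> W"
  shows "del_F h c g d f (del_map c d f) p \<alpha> $ \<gamma> $ i
    = wirt 1 c \<alpha> (s \<gamma> i) p - (\<Sum>\<mu>\<in>UNIV. chern h c \<mu> \<alpha> \<gamma> p * s \<mu> i p) + (\<Sum>k\<in>UNIV. conn 1 \<alpha> i k p * s \<gamma> k p)"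
proof -
  \<comment> \<open>The Chern term is complex-linear in the tangent vector, so its values at
    \<open>axis \<alpha> 1\<close> and \<open>axis \<alpha> \<i>\<close> differ by the factor
    \<open>\<i>\<close> and \<open>coeff10\<close> returns it unchanged.\<close>
  have 1: "(\<Sum>\<kappa>\<in>UNIV. \<Sum>\<mu>\<in>UNIV. axis \<alpha> x $ \<kappa> * chern h c \<mu> \<kappa> \<gamma> p * s \<mu> i p)
      = x * (\<Sum>\<mu>\<in>UNIV. chern h c \<mu> \<alpha> \<gamma> p * s \<mu> i p)" for x
  proof -
    have "(\<Sum>\<mu>\<in>UNIV. axis \<alpha> x $ \<kappa> * chern h c \<mu> \<kappa> \<gamma> p * s \<mu> i p)
        = (if \<kappa> = \<alpha> then x * (\<Sum>\<mu>\<in>UNIV. chern h c \<mu> \<alpha> \<gamma> p * s \<mu> i p) else 0)" for \<kappa>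
      by (simp add: axis_def sum_distrib_left mult.assoc)
    then show ?thesis by simp
  qed
  have 2: "(\<Sum>k\<in>UNIV. conn 1 \<alpha> i k p * s \<gamma> k p)
      = ((\<Sum>j\<in>UNIV. \<Sum>k\<in>UNIV. \<Gamma> i j k p * dirD c (y j) (axis \<alpha> 1) p * s \<gamma> k p)
        - \<i> * (\<Sum>j\<in>UNIV. \<Sum>k\<in>UNIV. \<Gamma> i j k p * dirD c (y j) (axis \<alpha> \<i>) p * s \<gamma> k p)) / 2"
  proof -
    have "(\<Sum>k\<in>UNIV. conn 1 \<alpha> i k p * s \<gamma> k p)
        = (\<Sum>j\<in>UNIV. \<Sum>k\<in>UNIV. \<Gamma> i j k p * wirt 1 c \<alpha> (y j) p * s \<gamma> k p)"
      unfolding sum_distrib_right by (rule sum.swap)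
    also have "\<dots> = (\<Sum>j\<in>UNIV. \<Sum>k\<in>UNIV. (\<Gamma> i j k p * dirD c (y j) (axis \<alpha> 1) p * s \<gamma> k p
        - \<i> * (\<Gamma> i j k p * dirD c (y j) (axis \<alpha> \<i>) p * s \<gamma> k p)) / 2)"
      by (intro sum.cong refl) (simp add: wirt_def[of 1 c \<alpha>] algebra_simps)
    finally show ?thesis
      by (simp only: sum_divide_distrib[symmetric] sum_subtractf sum_distrib_left[symmetric])
  qed
  have 3: "wirt 1 c \<alpha> (s \<gamma> i) p = (dirD c (s \<gamma> i) (axis \<alpha> 1) p - \<i> * dirD c (s \<gamma> i) (axis \<alpha> \<i>) p) / 2"
    by (simp add: wirt_def[of 1 c \<alpha>])
  show ?thesis
    unfolding del_F_def coeff10_def nabla_F_def del_map_def pdz_wirt vec_lambda_beta 1 2 3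
    by (simp add: field_simps)
qed

text \<open>The Christoffel symbols and the coordinates of \<open>f\<close> are real, so conjugation
  affects only the Chern symbols and the type of the derivatives. This recognises the second factor
  of the pairing inside \<open>ip_F\<close>.\<close>

lemma cnj_del_F:
  assumes p: "p \<in> W"
  shows "cnj (del_F h c g d f (del_map c d f) p \<beta> $ \<delta> $ j) = nabla_sbar \<beta> \<delta> j p"
proof -
  have "cnj (wirt 1 c \<beta> (s \<delta> j) p) = wirt (-1) c \<beta> (\<lambda>q. cnj (s \<delta> j q)) p"
    by (simp add: wirt_cnj wirt_y_diff[OF p])
  also have "\<dots> = wirt (-1) c \<beta> (sbar \<delta> j) p"
    by (rule W.wirt_cong[OF cnj_wirt_y(1) p])
  finally show ?thesis by (simp add: del_F_eq[OF p] cnj_wirt_y[OF p])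
qed

lemma wirt_bar_energy:
  assumes p: "p \<in> W"
  shows "wirt (-1) c \<beta> (\<lambda>q. \<Sum>\<gamma>\<in>UNIV. \<Sum>\<delta>\<in>UNIV. \<Sum>i\<in>UNIV. \<Sum>j\<in>UNIV. K \<gamma> \<delta> q * G i j q * s \<gamma> i q * sbar \<delta> j q) p
    = (\<Sum>\<gamma>\<in>UNIV. \<Sum>\<delta>\<in>UNIV. \<Sum>i\<in>UNIV. \<Sum>j\<in>UNIV. K \<gamma> \<delta> p * G i j p * s \<gamma> i p * nabla_sbar \<beta> \<delta> j p)"
proof -
  \<comment> \<open>Barred direction: \<open>P = 0\<close>. The Leibniz term that differentiates
    \<open>s\<close> then vanishes by pluri-harmonicity.\<close>
  have "wirt (-1) c \<beta> (K \<gamma> \<delta>) p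
      = - (\<Sum>\<mu>\<in>UNIV. 0 * K \<mu> \<delta> p) - (\<Sum>\<mu>\<in>UNIV. cnj (chern h c \<delta> \<beta> \<mu> p) * K \<gamma> \<mu> p)" for \<gamma> \<delta>
    using M.wirt_bar_K[of p] p by simp
  from leibniz[where S = s and T = sbar and P = "\<lambda>_ _. 0" and Q = "\<lambda>\<delta> \<mu>. cnj (chern h c \<delta> \<beta> \<mu> p)",
      OF p wirt_y_diff[OF p] wirt_y_diff[OF p] this]
  show ?thesis by (simp add: pluriharmonic_eq(1)[OF p] algebra_simps)
qed

text \<open>The curvature of the bundle acting on \<open>sbar\<close>: the Hessian contributes the
  curvature of the target, the derivative of the conjugated Chern symbols that of the source. The
  products of Chern symbols with \<open>conn 1\<close> cancel because \<open>sbar\<close> is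
  parallel in unbarred directions.\<close>

lemma wirt_nabla_sbar:
  assumes p: "p \<in> W"
  shows "wirt 1 c \<alpha> (nabla_sbar \<beta> \<delta> j) p + (\<Sum>k\<in>UNIV. conn 1 \<alpha> j k p * nabla_sbar \<beta> \<delta> k p)
    = (\<Sum>k\<in>UNIV. \<Sum>a\<in>UNIV. \<Sum>l\<in>UNIV.
        of_real (curv g d a l k j (f p)) * s \<alpha> a p * sbar \<delta> l p * sbar \<beta> k p)
      + (\<Sum>\<mu>\<in>UNIV. \<Sum>\<kappa>\<in>UNIV. K \<kappa> \<mu> p * RM h c \<alpha> \<beta> \<kappa> \<delta> p * sbar \<mu> j p)"
proof -
  have pc: "p \<in> cdom c" using p by simp
  have cc: "cinv c (cmap c p) = p" by (rule W.cinv_cmap[OF p])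
  note d = wirt_y_diff[OF p] chart_diff_cnj[OF M.chern_diff[OF pc]]
  let ?c = "\<lambda>\<mu> q. cnj (chern h c \<mu> \<beta> \<delta> q)"
  have "wirt 1 c \<alpha> (nabla_sbar \<beta> \<delta> j) p
      = wirt 1 c \<alpha> (\<lambda>q. hess \<beta> \<delta> j q + - (\<Sum>\<mu>\<in>UNIV. ?c \<mu> q * sbar \<mu> j q)) p" by simp
  also have "\<dots> = wirt 1 c \<alpha> (hess \<beta> \<delta> j) p + wirt 1 c \<alpha> (\<lambda>q. - (\<Sum>\<mu>\<in>UNIV. ?c \<mu> q * sbar \<mu> j q)) p"
    by (intro wirt_add hess_diff[OF p] chart_diff_minus chart_diff_sum chart_diff_mult d cc)
  also have "wirt 1 c \<alpha> (\<lambda>q. - (\<Sum>\<mu>\<in>UNIV. ?c \<mu> q * sbar \<mu> j q)) p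
      = - wirt 1 c \<alpha> (\<lambda>q. \<Sum>\<mu>\<in>UNIV. ?c \<mu> q * sbar \<mu> j q) p"
    by (intro wirt_minus chart_diff_sum chart_diff_mult d cc)
  also have "wirt 1 c \<alpha> (\<lambda>q. \<Sum>\<mu>\<in>UNIV. ?c \<mu> q * sbar \<mu> j q) p
      = (\<Sum>\<mu>\<in>UNIV. wirt 1 c \<alpha> (\<lambda>q. ?c \<mu> q * sbar \<mu> j q) p)"
    by (intro wirt_sum chart_diff_mult d cc)
  also have "\<dots> = (\<Sum>\<mu>\<in>UNIV. wirt 1 c \<alpha> (?c \<mu>) p * sbar \<mu> j p + ?c \<mu> p * wirt 1 c \<alpha> (sbar \<mu> j) p)"
    by (intro sum.cong refl wirt_mult d cc)
  also have "\<dots> = - (\<Sum>\<mu>\<in>UNIV. \<Sum>\<kappa>\<in>UNIV. K \<kappa> \<mu> p * RM h c \<alpha> \<beta> \<kappa> \<delta> p * sbar \<mu> j p)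
      - (\<Sum>\<mu>\<in>UNIV. \<Sum>k\<in>UNIV. ?c \<mu> p * (conn 1 \<alpha> j k p * sbar \<mu> k p))"
    unfolding M.wirt_cnj_chern[OF pc] pluriharmonic_eq(2)[OF p] sum.distrib mult_minus_right
      mult_minus_left sum_negf
    by (simp only: sum_distrib_left sum_distrib_right diff_conv_add_uminus)
  finally have 1: "wirt 1 c \<alpha> (nabla_sbar \<beta> \<delta> j) p = wirt 1 c \<alpha> (hess \<beta> \<delta> j) p
      + (\<Sum>\<mu>\<in>UNIV. \<Sum>\<kappa>\<in>UNIV. K \<kappa> \<mu> p * RM h c \<alpha> \<beta> \<kappa> \<delta> p * sbar \<mu> j p)
      + (\<Sum>\<mu>\<in>UNIV. \<Sum>k\<in>UNIV. ?c \<mu> p * (conn 1 \<alpha> j k p * sbar \<mu> k p))" by (simp only: minus_diff_eq) simp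
  have "(\<Sum>k\<in>UNIV. conn 1 \<alpha> j k p * nabla_sbar \<beta> \<delta> k p) = (\<Sum>k\<in>UNIV. conn 1 \<alpha> j k p * hess \<beta> \<delta> k p)
      - (\<Sum>k\<in>UNIV. conn 1 \<alpha> j k p * (\<Sum>\<mu>\<in>UNIV. ?c \<mu> p * sbar \<mu> k p))"
    by (simp only: right_diff_distrib sum_subtractf)
  also have "(\<Sum>k\<in>UNIV. conn 1 \<alpha> j k p * (\<Sum>\<mu>\<in>UNIV. ?c \<mu> p * sbar \<mu> k p))
      = (\<Sum>\<mu>\<in>UNIV. \<Sum>k\<in>UNIV. ?c \<mu> p * (conn 1 \<alpha> j k p * sbar \<mu> k p))"
    unfolding sum_distrib_left[where f = "\<lambda>\<mu>. ?c \<mu> p * _ \<mu>"] by (subst sum.swap) (simp only: mult.left_commute)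
  finally show ?thesis unfolding 1 wirt_hess[OF p, symmetric] by simp
qed

lemma wirt_wirt_bar_energy:
  assumes p: "p \<in> W"
  shows "wirt 1 c \<alpha> (wirt (-1) c \<beta> (\<lambda>q. \<Sum>\<gamma>\<in>UNIV. \<Sum>\<delta>\<in>UNIV. \<Sum>i\<in>UNIV. \<Sum>j\<in>UNIV.
      K \<gamma> \<delta> q * G i j q * s \<gamma> i q * sbar \<delta> j q)) p
    = ip_F (h c p) (g d (f p)) (del_F h c g d f (del_map c d f) p \<alpha>) (del_F h c g d f (del_map c d f) p \<beta>)
    + ((\<Sum>\<gamma>\<in>UNIV. \<Sum>\<delta>\<in>UNIV. \<Sum>\<mu>\<in>UNIV. \<Sum>\<nu>\<in>UNIV. \<Sum>i\<in>UNIV. \<Sum>j\<in>UNIV.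
         RM h c \<alpha> \<beta> \<gamma> \<delta> p * K \<gamma> \<nu> p * K \<mu> \<delta> p * G i j p * s \<mu> i p * sbar \<nu> j p)
      - (\<Sum>i\<in>UNIV. \<Sum>j\<in>UNIV. \<Sum>k\<in>UNIV. \<Sum>l\<in>UNIV.
         of_real (RN g d i l k j (f p)) * s \<alpha> i p * sbar \<beta> j p
         * (\<Sum>\<gamma>\<in>UNIV. \<Sum>\<delta>\<in>UNIV. K \<gamma> \<delta> p * s \<gamma> k p * sbar \<delta> l p)))"
proof -
  have pc: "p \<in> cdom c" and q: "f p \<in> cdom d" using p by auto
  have nd: "chart_diff c (nabla_sbar \<beta> \<delta> j) p" for \<delta> j
  proof -
    have "chart_diff c (\<lambda>q. hess \<beta> \<delta> j q + - (\<Sum>\<mu>\<in>UNIV. cnj (chern h c \<mu> \<beta> \<delta> q) * sbar \<mu> j q)) p"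
      by (intro chart_diff_add hess_diff[OF p] chart_diff_minus chart_diff_sum chart_diff_mult
          wirt_y_diff[OF p] chart_diff_cnj M.chern_diff[OF pc] W.cinv_cmap[OF p])
    then show ?thesis by simp
  qed
  \<comment> \<open>Unbarred direction: the Chern connection now acts on the first factor, hence
    \<open>Q = 0\<close>.\<close>
  have dK: "wirt 1 c \<alpha> (K \<gamma> \<delta>) p
      = - (\<Sum>\<mu>\<in>UNIV. chern h c \<gamma> \<alpha> \<mu> p * K \<mu> \<delta> p) - (\<Sum>\<mu>\<in>UNIV. 0 * K \<gamma> \<mu> p)" for \<gamma> \<delta>
    using M.wirt_K[OF pc] by simp
  let ?R = "\<lambda>\<delta> j. \<Sum>k\<in>UNIV. \<Sum>a\<in>UNIV. \<Sum>l\<in>UNIV.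
        complex_of_real (curv g d a l k j (f p)) * s \<alpha> a p * sbar \<delta> l p * sbar \<beta> k p"
  let ?S = "\<lambda>\<delta> j. \<Sum>\<mu>\<in>UNIV. \<Sum>\<kappa>\<in>UNIV. K \<kappa> \<mu> p * RM h c \<alpha> \<beta> \<kappa> \<delta> p * sbar \<mu> j p"
  have "wirt 1 c \<alpha> (wirt (-1) c \<beta> (\<lambda>q. \<Sum>\<gamma>\<in>UNIV. \<Sum>\<delta>\<in>UNIV. \<Sum>i\<in>UNIV. \<Sum>j\<in>UNIV.
      K \<gamma> \<delta> q * G i j q * s \<gamma> i q * sbar \<delta> j q)) p
    = wirt 1 c \<alpha> (\<lambda>q. \<Sum>\<gamma>\<in>UNIV. \<Sum>\<delta>\<in>UNIV. \<Sum>i\<in>UNIV. \<Sum>j\<in>UNIV.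
      K \<gamma> \<delta> q * G i j q * s \<gamma> i q * nabla_sbar \<beta> \<delta> j q) p"
    by (rule W.wirt_cong[OF wirt_bar_energy p])
  also have "\<dots> = (\<Sum>\<gamma>\<in>UNIV. \<Sum>\<delta>\<in>UNIV. \<Sum>i\<in>UNIV. \<Sum>j\<in>UNIV. K \<gamma> \<delta> p * G i j p
        * (wirt 1 c \<alpha> (s \<gamma> i) p - (\<Sum>\<mu>\<in>UNIV. chern h c \<mu> \<alpha> \<gamma> p * s \<mu> i p)
            + (\<Sum>k\<in>UNIV. conn 1 \<alpha> i k p * s \<gamma> k p)) * nabla_sbar \<beta> \<delta> j p)
    + (\<Sum>\<gamma>\<in>UNIV. \<Sum>\<delta>\<in>UNIV. \<Sum>i\<in>UNIV. \<Sum>j\<in>UNIV. K \<gamma> \<delta> p * G i j p * s \<gamma> i p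
        * (wirt 1 c \<alpha> (nabla_sbar \<beta> \<delta> j) p - (\<Sum>\<mu>\<in>UNIV. 0 * nabla_sbar \<beta> \<mu> j p)
            + (\<Sum>k\<in>UNIV. conn 1 \<alpha> j k p * nabla_sbar \<beta> \<delta> k p)))"
    by (rule leibniz[where S = s and T = "nabla_sbar \<beta>" and P = "\<lambda>\<mu> \<gamma>. chern h c \<mu> \<alpha> \<gamma> p" and Q = "\<lambda>_ _. 0",
        OF p wirt_y_diff[OF p] nd dK])
  also have "(\<Sum>\<gamma>\<in>UNIV. \<Sum>\<delta>\<in>UNIV. \<Sum>i\<in>UNIV. \<Sum>j\<in>UNIV. K \<gamma> \<delta> p * G i j p
        * (wirt 1 c \<alpha> (s \<gamma> i) p - (\<Sum>\<mu>\<in>UNIV. chern h c \<mu> \<alpha> \<gamma> p * s \<mu> i p)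
            + (\<Sum>k\<in>UNIV. conn 1 \<alpha> i k p * s \<gamma> k p)) * nabla_sbar \<beta> \<delta> j p)
      = ip_F (h c p) (g d (f p)) (del_F h c g d f (del_map c d f) p \<alpha>) (del_F h c g d f (del_map c d f) p \<beta>)"
    by (simp only: ip_F_def del_F_eq[OF p, of \<alpha>] cnj_del_F[OF p])
  also have "(\<Sum>\<gamma>\<in>UNIV. \<Sum>\<delta>\<in>UNIV. \<Sum>i\<in>UNIV. \<Sum>j\<in>UNIV. K \<gamma> \<delta> p * G i j p * s \<gamma> i p
        * (wirt 1 c \<alpha> (nabla_sbar \<beta> \<delta> j) p - (\<Sum>\<mu>\<in>UNIV. 0 * nabla_sbar \<beta> \<mu> j p)
            + (\<Sum>k\<in>UNIV. conn 1 \<alpha> j k p * nabla_sbar \<beta> \<delta> k p)))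
      = (\<Sum>\<gamma>\<in>UNIV. \<Sum>\<delta>\<in>UNIV. \<Sum>i\<in>UNIV. \<Sum>j\<in>UNIV. K \<gamma> \<delta> p * G i j p * s \<gamma> i p * ?S \<delta> j)
      + (\<Sum>\<gamma>\<in>UNIV. \<Sum>\<delta>\<in>UNIV. \<Sum>i\<in>UNIV. \<Sum>j\<in>UNIV. K \<gamma> \<delta> p * G i j p * s \<gamma> i p * ?R \<delta> j)"
    by (simp only: mult_zero_left sum.neutral_const diff_0_right wirt_nabla_sbar[OF p] distrib_left sum.distrib add.commute)
  \<comment> \<open>Pure renaming: the outer \<open>\<gamma>\<close> becomes \<open>\<mu>\<close>,
    and the indices \<open>\<kappa>\<close> and \<open>\<mu>\<close> of \<open>?S\<close> become
    \<open>\<gamma>\<close> and \<open>\<nu>\<close>.\<close>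
  also have "(\<Sum>\<gamma>\<in>UNIV. \<Sum>\<delta>\<in>UNIV. \<Sum>i\<in>UNIV. \<Sum>j\<in>UNIV. K \<gamma> \<delta> p * G i j p * s \<gamma> i p * ?S \<delta> j)
      = (\<Sum>\<gamma>\<in>UNIV. \<Sum>\<delta>\<in>UNIV. \<Sum>\<mu>\<in>UNIV. \<Sum>\<nu>\<in>UNIV. \<Sum>i\<in>UNIV. \<Sum>j\<in>UNIV.
         RM h c \<alpha> \<beta> \<gamma> \<delta> p * K \<gamma> \<nu> p * K \<mu> \<delta> p * G i j p * s \<mu> i p * sbar \<nu> j p)"
    unfolding sum_distrib_left sum_distrib_right unfolding sum.cartesian_product
    by (rule sum.reindex_bij_witness[of _ "\<lambda>(\<gamma>, \<delta>, \<mu>, \<nu>, i, j). (\<mu>, \<delta>, i, j, \<nu>, \<gamma>)"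
        "\<lambda>(\<mu>, \<delta>, i, j, \<nu>, \<gamma>). (\<gamma>, \<delta>, \<mu>, \<nu>, i, j)"]) auto
  also have "(\<Sum>\<gamma>\<in>UNIV. \<Sum>\<delta>\<in>UNIV. \<Sum>i\<in>UNIV. \<Sum>j\<in>UNIV. K \<gamma> \<delta> p * G i j p * s \<gamma> i p * ?R \<delta> j)
      = - (\<Sum>i\<in>UNIV. \<Sum>j\<in>UNIV. \<Sum>k\<in>UNIV. \<Sum>l\<in>UNIV.
         of_real (RN g d i l k j (f p)) * s \<alpha> i p * sbar \<beta> j p
         * (\<Sum>\<gamma>\<in>UNIV. \<Sum>\<delta>\<in>UNIV. K \<gamma> \<delta> p * s \<gamma> k p * sbar \<delta> l p))"
  proof -
    \<comment> \<open>The metric lowers the upper index of \<open>curv\<close> to the fourth place,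
      while the statement has it in the third; antisymmetry in the last two indices repairs this at
      the cost of the sign.\<close>
    have "RN g d i l k j (f p) = - (\<Sum>a\<in>UNIV. g d (f p) $ k $ a * curv g d i l j a (f p))" for i j k l
      using N.RN_antisym[OF q, of i l k j] N.g_sym[OF q] by (simp add: RN_curv)
    then have "- (\<Sum>i\<in>UNIV. \<Sum>j\<in>UNIV. \<Sum>k\<in>UNIV. \<Sum>l\<in>UNIV.
         of_real (RN g d i l k j (f p)) * s \<alpha> i p * sbar \<beta> j p
         * (\<Sum>\<gamma>\<in>UNIV. \<Sum>\<delta>\<in>UNIV. K \<gamma> \<delta> p * s \<gamma> k p * sbar \<delta> l p))
      = (\<Sum>i\<in>UNIV. \<Sum>j\<in>UNIV. \<Sum>k\<in>UNIV. \<Sum>l\<in>UNIV.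
         (\<Sum>a\<in>UNIV. G k a p * of_real (curv g d i l j a (f p))) * s \<alpha> i p * sbar \<beta> j p
         * (\<Sum>\<gamma>\<in>UNIV. \<Sum>\<delta>\<in>UNIV. K \<gamma> \<delta> p * s \<gamma> k p * sbar \<delta> l p))"
      by (simp add: sum_negf)
    also have "\<dots> = (\<Sum>\<gamma>\<in>UNIV. \<Sum>\<delta>\<in>UNIV. \<Sum>i\<in>UNIV. \<Sum>j\<in>UNIV. K \<gamma> \<delta> p * G i j p * s \<gamma> i p * ?R \<delta> j)"
      unfolding sum_distrib_left sum_distrib_right unfolding sum.cartesian_product
      by (rule sum.reindex_bij_witness[of _ "\<lambda>(\<gamma>, \<delta>, k, a, j, i, l). (i, j, k, l, \<gamma>, \<delta>, a)"
          "\<lambda>(i, j, k, l, \<gamma>, \<delta>, a). (\<gamma>, \<delta>, k, a, j, i, l)"]) auto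
    finally show ?thesis by simp
  qed
  finally show ?thesis by simp
qed

end

theorem proposition1p7:
  fixes A :: "('a::{t2_space,second_countable_topology}, complex^'m) chart set"
    and h :: "('a, complex^'m) chart \<Rightarrow> 'a \<Rightarrow> complex^'m^'m"
    and B :: "('b::{t2_space,second_countable_topology}, real^'n) chart set"
    and g :: "('b, real^'n) chart \<Rightarrow> 'b \<Rightarrow> real^'n^'n"
    and f :: "'a \<Rightarrow> 'b"
    and u :: "'a \<Rightarrow> complex"
  assumes M: "hermitian_manifold A h"
    and N: "riemannian_manifold B g"
    and f: "smooth_map A B f" "pluriharmonic A B g f"
    and u: "u = energy_density A h B g f"
    and c: "c \<in> A" "p \<in> cdom c"
    and d: "d \<in> B" "f p \<in> cdom d"
  shows "del_delbar c u p v w =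
      bracket_F (h c p) (g d (f p))
        (del_F h c g d f (del_map c d f) p) (del_F h c g d f (del_map c d f) p) v w
    + form11 (\<lambda>\<alpha> \<beta>.
        (\<Sum>\<gamma>\<in>UNIV. \<Sum>\<delta>\<in>UNIV. \<Sum>\<mu>\<in>UNIV. \<Sum>\<nu>\<in>UNIV. \<Sum>i\<in>UNIV. \<Sum>j\<in>UNIV.
           RM h c \<alpha> \<beta> \<gamma> \<delta> p * upper (h c p) \<gamma> \<nu> * upper (h c p) \<mu> \<delta>
           * complex_of_real (g d (f p) $ i $ j)
           * pdz c \<mu> (coord_f d f i) p * pdzbar c \<nu> (coord_f d f j) p)
      - (\<Sum>i\<in>UNIV. \<Sum>j\<in>UNIV. \<Sum>k\<in>UNIV. \<Sum>l\<in>UNIV.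
           complex_of_real (RN g d i l k j (f p))
           * pdz c \<alpha> (coord_f d f i) p * pdzbar c \<beta> (coord_f d f j) p
           * (\<Sum>\<gamma>\<in>UNIV. \<Sum>\<delta>\<in>UNIV. upper (h c p) \<gamma> \<delta>
                * pdz c \<gamma> (coord_f d f k) p * pdzbar c \<delta> (coord_f d f l) p))) v w"
proof -
  interpret pluriharmonic_chart A h c B g d f
    using M N f c(1) d(1) by unfold_locales
  have p: "p \<in> W" using c d by simp
  \<comment> \<open>The charts chosen inside \<open>energy_density\<close> vary with the point. On
    \<open>W\<close> they are replaced by the fixed pair \<open>c\<close>, \<open>d\<close>; the
    equality is needed on all of \<open>W\<close>, since it is differentiated twice.\<close>
  have u_eq: "u q = (\<Sum>\<gamma>\<in>UNIV. \<Sum>\<delta>\<in>UNIV. \<Sum>i\<in>UNIV. \<Sum>j\<in>UNIV. K \<gamma> \<delta> q * G i j q * s \<gamma> i q * sbar \<delta> j q)"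
    if "q \<in> W" for q
    using energy_density_eq[OF M N f(1) c(1) _ d(1)] that
    by (simp add: u ip_F_def del_map_def pdz_wirt cnj_wirt_y)
  have "wirt 1 c \<alpha> (wirt (-1) c \<beta> u) p
      = wirt 1 c \<alpha> (wirt (-1) c \<beta> (\<lambda>q. \<Sum>\<gamma>\<in>UNIV. \<Sum>\<delta>\<in>UNIV. \<Sum>i\<in>UNIV. \<Sum>j\<in>UNIV.
          K \<gamma> \<delta> q * G i j q * s \<gamma> i q * sbar \<delta> j q)) p" for \<alpha> \<beta>
    by (intro W.wirt_cong[OF W.wirt_cong[OF u_eq] p])
  then show ?thesis
    unfolding del_delbar_def bracket_F_def form11_add pdz_wirt pdzbar_wirt
    by (simp only: wirt_wirt_bar_energy[OF p])
qed

end
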